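(* Let $K$ be a field and let $G$ be a graph on the vertex set $V(G)=\{x_1,\dots,x_n\}$, $n\geq 1$. Let $\{W_1,\dots,W_t\}$ be a partition of $V(G)$. Let $G'$ be the graph obtained from $G$ by adding, for each $i=1,\dots,t$, one new vertex $y_i$ (with $y_1,\dots,y_t$ pairwise distinct and not in $V(G)$) and the edge $x_jy_i$ for every $x_j\in W_i$; that is, $V(G')=V(G)\cup\{y_1,\dots,y_t\}$ and $E(G')=E(G)\cup\{\,x_jy_i \mid 1\leq i\leq t,\ x_j\in W_i\,\}$. Let $I(G')\subset K[x_1,\dots,x_n,y_1,\dots,y_t]$ be the edge ideal of $G'$. Then $$\operatorname{bight} I(G')=\operatorname{ara} I(G')=n.$$ In particular, the edge ideal of every fully clique-whiskered graph is a set-theoretic complete intersection.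
   Context: Graphs are finite and simple. The vertices of a graph are identified with indeterminates over a field $K$. The edge ideal of a graph $H$ is the ideal $I(H)$, in the polynomial ring over $K$ whose indeterminates are the vertices of $H$, generated by the products $uv$ for all edges $\{u,v\}\in E(H)$. For a proper ideal $I$ of a Noetherian commutative ring $R$ with identity, the arithmetical rank $\operatorname{ara} I$ is the smallest integer $s$ for which there exist $a_1,\dots,a_s\in R$ with $\sqrt{(a_1,\dots,a_s)}=\sqrt{I}$. The big height $\operatorname{bight} I$ is the maximum of the heights of the minimal prime ideals of $I$. The ideal $I$ is called a set-theoretic complete intersection if $\operatorname{ara} I=\operatorname{ht} I$, where $\operatorname{ht} I$ is the height of $I$. A clique of a graph $G$ is a subset of $V(G)$ inducing a complete subgraph. A clique vertex-partition of $G$ is a set $\pi=\{W_1,\dots,W_t\}$ of pairwise disjoint (possibly empty) cliques of $G$ whose union is $V(G)$. The associated fully clique-whiskered graph $G^\pi$ has vertex set $V(G)\cup\{w_1,\dots,w_t\}$, where $w_1,\dots,w_t$ are distinct new vertices, and edge set $E(G)\cup\{\,vw_i \mid 1\leq i\leq t,\ v\in W_i\,\}$. *)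

theory Defs
  imports "HOL-Algebra.Ideal" "HOL-Library.Disjoint_Sets" "HOL-Library.Poly_Mapping" "HOL-Library.Extended_Nat"
begin

section \<open>Heights, big height and arithmetical rank\<close>

definition radical :: "('a, 'b) ring_scheme \<Rightarrow> 'a set \<Rightarrow> 'a set" where
  "radical R I = {a \<in> carrier R. \<exists>m::nat. a [^]\<^bsub>R\<^esub> m \<in> I}"

text \<open>Heights are extended naturals, so that a prime with arbitrarily long chains below it
  has height \<^term>\<open>\<infinity> :: enat\<close> rather than an unspecified value.\<close>

definition prime_height :: "('a, 'b) ring_scheme \<Rightarrow> 'a set \<Rightarrow> enat" where
  "prime_height R P = (SUP k \<in> {k::nat. \<exists>C :: nat \<Rightarrow> 'a set.
      (\<forall>i\<le>k. primeideal (C i) R) \<and> (\<forall>i<k. C i \<subset> C (Suc i)) \<and> C k = P}. enat k)"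

definition height :: "('a, 'b) ring_scheme \<Rightarrow> 'a set \<Rightarrow> enat" where
  "height R I = (INF P \<in> {P. primeideal P R \<and> I \<subseteq> P}. prime_height R P)"

definition minimal_primes :: "('a, 'b) ring_scheme \<Rightarrow> 'a set \<Rightarrow> 'a set set" where
  "minimal_primes R I = {P. primeideal P R \<and> I \<subseteq> P \<and>
      (\<forall>Q. primeideal Q R \<and> I \<subseteq> Q \<and> Q \<subseteq> P \<longrightarrow> Q = P)}"

text \<open>A supremum in \<^typ>\<open>enat\<close> that is finite and nonzero is attained, hence a maximum.\<close>

definition bight :: "('a, 'b) ring_scheme \<Rightarrow> 'a set \<Rightarrow> enat" where
  "bight R I = (SUP P \<in> minimal_primes R I. prime_height R P)"

text \<open>Any infimum of a nonempty set in \<^typ>\<open>enat\<close> is attained. The value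
  \<^term>\<open>\<infinity> :: enat\<close> signals that no finite family works, which cannot happen in a
  Noetherian ring.\<close>

definition ara :: "('a, 'b) ring_scheme \<Rightarrow> 'a set \<Rightarrow> enat" where
  "ara R I = (INF s \<in> {s::nat. \<exists>as. length as = s \<and> set as \<subseteq> carrier R \<and>
      radical R (Idl\<^bsub>R\<^esub> (set as)) = radical R I}. enat s)"

definition set_theoretic_complete_intersection ::
    "('a, 'b) ring_scheme \<Rightarrow> 'a set \<Rightarrow> bool" where
  "set_theoretic_complete_intersection R I \<longleftrightarrow> ara R I = height R I"


section \<open>Polynomial rings and edge ideals\<close>

text \<open>A monomial is a finitely supported exponent vector \<^typ>\<open>'v \<Rightarrow>\<^sub>0 nat\<close>. The polynomial ring
  in the indeterminates \<open>V\<close> consists of the polynomials all of whose monomials involve only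
  elements of \<open>V\<close>; other elements of the type \<open>'v\<close> are not indeterminates of the ring.\<close>

definition mpoly_ring :: "'v set \<Rightarrow> (('v \<Rightarrow>\<^sub>0 nat) \<Rightarrow>\<^sub>0 'k::comm_ring_1) ring" where
  "mpoly_ring V = \<lparr>carrier = {p. \<forall>m \<in> Poly_Mapping.keys p. Poly_Mapping.keys m \<subseteq> V},
     monoid.mult = (*), one = 1, zero = 0, add = (+)\<rparr>"

definition indet :: "'v \<Rightarrow> ('v \<Rightarrow>\<^sub>0 nat) \<Rightarrow>\<^sub>0 'k::comm_ring_1" where
  "indet v = Poly_Mapping.single (Poly_Mapping.single v 1) 1"

definition simple_graph :: "'v set \<Rightarrow> 'v set set \<Rightarrow> bool" where
  "simple_graph V E \<longleftrightarrow> finite V \<and> (\<forall>e\<in>E. e \<subseteq> V \<and> card e = 2)"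

definition edge_ideal :: "'v set \<Rightarrow> 'v set set \<Rightarrow> (('v \<Rightarrow>\<^sub>0 nat) \<Rightarrow>\<^sub>0 'k::field) set" where
  "edge_ideal V E = Idl\<^bsub>mpoly_ring V\<^esub> {indet u * indet v | u v. {u, v} \<in> E}"

lemma cring_mpoly_ring:
  "cring (mpoly_ring V :: (('v \<Rightarrow>\<^sub>0 nat) \<Rightarrow>\<^sub>0 'k::comm_ring_1) ring)" (is "cring ?R")
proof (rule cringI)
  have add: "p \<oplus>\<^bsub>?R\<^esub> q \<in> carrier ?R" if "p \<in> carrier ?R" "q \<in> carrier ?R" for p q
    using that Poly_Mapping.keys_add[of p q] by (auto simp: mpoly_ring_def)
  have mult: "p \<otimes>\<^bsub>?R\<^esub> q \<in> carrier ?R" if "p \<in> carrier ?R" "q \<in> carrier ?R" for p q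
    unfolding mpoly_ring_def
  proof clarsimp
    fix m x assume m: "m \<in> Poly_Mapping.keys (p * q)" and x: "x \<in> Poly_Mapping.keys m"
    from m obtain a b where "m = a + b" "a \<in> Poly_Mapping.keys p" "b \<in> Poly_Mapping.keys q"
      using keys_mult[of p q] by blast
    with x that show "x \<in> V"
      using Poly_Mapping.keys_add[of a b] by (simp add: mpoly_ring_def) blast
  qed
  show "abelian_group ?R"
  proof (rule abelian_groupI)
    show "\<exists>q\<in>carrier ?R. q \<oplus>\<^bsub>?R\<^esub> p = \<zero>\<^bsub>?R\<^esub>" if "p \<in> carrier ?R" for p
      using that by (intro bexI[of _ "- p"]) (simp_all add: mpoly_ring_def)
  qed (fact add, simp_all add: mpoly_ring_def add.assoc add.commute)
  show "comm_monoid ?R"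
    by (rule comm_monoidI, fact mult)
      (simp_all add: mpoly_ring_def mult.assoc mult.commute)
qed (simp add: mpoly_ring_def distrib_right)


section \<open>Whiskered graphs\<close>

text \<open>The blocks are an indexed family \<open>W 1, \<dots>, W t\<close>, and some of them may be empty.\<close>

definition indexed_partition :: "'v set \<Rightarrow> nat \<Rightarrow> (nat \<Rightarrow> 'v set) \<Rightarrow> bool" where
  "indexed_partition V t W \<longleftrightarrow> disjoint_family_on W {1..t} \<and> (\<Union>i\<in>{1..t}. W i) = V"

definition new_vertices :: "'v set \<Rightarrow> nat \<Rightarrow> (nat \<Rightarrow> 'v) \<Rightarrow> bool" where
  "new_vertices V t y \<longleftrightarrow> inj_on y {1..t} \<and> y ` {1..t} \<inter> V = {}"

definition whisker_vertices :: "'v set \<Rightarrow> nat \<Rightarrow> (nat \<Rightarrow> 'v) \<Rightarrow> 'v set" where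
  "whisker_vertices V t y = V \<union> y ` {1..t}"

definition whisker_edges ::
    "'v set set \<Rightarrow> nat \<Rightarrow> (nat \<Rightarrow> 'v set) \<Rightarrow> (nat \<Rightarrow> 'v) \<Rightarrow> 'v set set" where
  "whisker_edges E t W y = E \<union> {{x, y i} | x i. i \<in> {1..t} \<and> x \<in> W i}"

definition clique :: "'v set \<Rightarrow> 'v set set \<Rightarrow> 'v set \<Rightarrow> bool" where
  "clique V E S \<longleftrightarrow> S \<subseteq> V \<and> (\<forall>u\<in>S. \<forall>v\<in>S. u \<noteq> v \<longrightarrow> {u, v} \<in> E)"

definition fully_clique_whiskered :: "'v set \<Rightarrow> 'v set set \<Rightarrow> bool" where
  "fully_clique_whiskered V' E' \<longleftrightarrow>
     (\<exists>V E t W w. simple_graph V E \<and> indexed_partition V t W \<and>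
        (\<forall>i\<in>{1..t}. clique V E (W i)) \<and> new_vertices V t w \<and>
        V' = whisker_vertices V t w \<and> E' = whisker_edges E t W w)"

end

theory Submission
  imports Defs
begin

text \<open>
  Let \<open>w x\<close> be the new vertex joined to \<open>x \<in> V\<close>, and \<open>Y\<close> the set of all new vertices. The partition enters
  the whiskered graph, with vertex set \<open>Z = V \<union> Y\<close>, only through \<open>w\<close>, so the proof is carried out for an
  arbitrary map \<open>w\<close> from \<open>V\<close> to \<open>Y\<close>. Let \<open>I\<close> be the edge ideal.

  \<^bold>\<open>Big height.\<close> The set of variables lying in a prime over \<open>I\<close> is a vertex cover, and the polynomials
  all of whose monomials meet a given cover \<open>C\<close> form a prime \<open>var_prime Z C\<close> over \<open>I\<close>. Hence the minimal
  primes are those of the minimal covers. A minimal cover contains a new vertex \<open>y\<close> only if it misses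
  some \<open>x\<close> with \<open>w x = y\<close>, so it has at most \<open>card V\<close> elements; and \<open>V\<close> itself is a minimal cover.
  It remains that \<open>var_prime Z C\<close> has height \<open>card C\<close>. Adjoining variables one by one gives a chain of that
  length. For the upper bound, pick one element in each step of a chain of primes ending at
  \<open>var_prime Z C\<close>: these elements together with the variables outside \<open>C\<close> are algebraically independent.
  Comparing the number of products of their powers with the dimension of the space of polynomials
  that contains them bounds the length of the chain (\<open>growth_step\<close>, \<open>growth_le_card\<close>).

  \<^bold>\<open>Arithmetical rank, upper bound.\<close> For \<open>{} \<noteq> A \<subseteq> V\<close> let \<open>g A\<close> be \<open>\<Prod>x\<in>A. x\<close> if \<open>A\<close> contains an edge of
  the original graph, and \<open>\<Prod>x\<in>A. x * w x\<close> otherwise. All \<open>g A\<close> lie in \<open>I\<close>, the singletons and the edges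
  give generators of \<open>I\<close>, and \<open>g (A \<union> B)\<close> divides \<open>g A * g B\<close>. So, in the manner of Schmitt and Vogel, the
  \<open>card V\<close> sums of all \<open>g A\<close> with \<open>card A = l\<close> generate \<open>I\<close> up to radical: downward induction on
  \<open>card A\<close> (\<open>radical_of_layer_sums\<close>).

  \<^bold>\<open>Arithmetical rank, lower bound.\<close> Setting all new vertices to \<open>1\<close> turns the generators \<open>x * w x\<close> into
  the variables \<open>x \<in> V\<close>. If \<open>s\<close> polynomials generate \<open>I\<close> up to radical, their images are \<open>s\<close> polynomials
  without constant term that generate an ideal containing a power of every \<open>x \<in> V\<close>. Modulo
  polynomials of order at least \<open>j\<close>, the ring in the variables \<open>V\<close> is then spanned by \<open>O(j ^ s)\<close> products, whereas
  its dimension grows like \<open>j ^ card V\<close>; so \<open>card V \<le> s\<close> (\<open>card_le_number_of_generators\<close>).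

  If the blocks of the partition are cliques, a vertex cover misses at most one element of each
  clique formed by a block and its whisker, so all covers have at least \<open>card V\<close> elements and the height is \<open>card V\<close> too.
\<close>

section \<open>Polynomials as finitely supported coefficient functions\<close>

definition polys :: "'v set \<Rightarrow> (('v \<Rightarrow>\<^sub>0 nat) \<Rightarrow>\<^sub>0 'k::comm_ring_1) set" where
  "polys V = {p. \<forall>m \<in> Poly_Mapping.keys p. Poly_Mapping.keys m \<subseteq> V}"

lemma mpoly_ring_simps [simp]:
  "carrier (mpoly_ring V) = polys V"
  "p \<otimes>\<^bsub>mpoly_ring V\<^esub> q = p * q" "p \<oplus>\<^bsub>mpoly_ring V\<^esub> q = p + q"
  "\<one>\<^bsub>mpoly_ring V\<^esub> = 1" "\<zero>\<^bsub>mpoly_ring V\<^esub> = 0"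
  by (simp_all add: mpoly_ring_def polys_def)

lemma mpoly_ring_pow [simp]: "p [^]\<^bsub>mpoly_ring V\<^esub> (k::nat) = p ^ k"
  by (induction k) (simp_all add: nat_pow_def mult.commute)

lemma polys_closed [simp, intro]:
  fixes p q :: "('v \<Rightarrow>\<^sub>0 nat) \<Rightarrow>\<^sub>0 'k::comm_ring_1"
  shows "(0 :: ('v \<Rightarrow>\<^sub>0 nat) \<Rightarrow>\<^sub>0 'k) \<in> polys V" "(1 :: ('v \<Rightarrow>\<^sub>0 nat) \<Rightarrow>\<^sub>0 'k) \<in> polys V"
    "p \<in> polys V \<Longrightarrow> q \<in> polys V \<Longrightarrow> p + q \<in> polys V"
    "p \<in> polys V \<Longrightarrow> q \<in> polys V \<Longrightarrow> p * q \<in> polys V"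
proof -
  interpret R: cring "mpoly_ring V :: (('v \<Rightarrow>\<^sub>0 nat) \<Rightarrow>\<^sub>0 'k) ring"
    by (rule cring_mpoly_ring)
  show "(0 :: ('v \<Rightarrow>\<^sub>0 nat) \<Rightarrow>\<^sub>0 'k) \<in> polys V" "(1 :: ('v \<Rightarrow>\<^sub>0 nat) \<Rightarrow>\<^sub>0 'k) \<in> polys V"
    using R.zero_closed R.one_closed by simp_all
  show "p \<in> polys V \<Longrightarrow> q \<in> polys V \<Longrightarrow> p + q \<in> polys V"
    "p \<in> polys V \<Longrightarrow> q \<in> polys V \<Longrightarrow> p * q \<in> polys V"
    using R.a_closed[of p q] R.m_closed[of p q] by simp_all
qed

lemma polys_uminus [simp, intro]: "p \<in> polys V \<Longrightarrow> - p \<in> polys V"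
  by (simp add: polys_def)

lemma polys_power [simp, intro]: "p \<in> polys V \<Longrightarrow> p ^ k \<in> polys V"
  by (induction k) auto

lemma polys_sum [intro]: "(\<And>i. i \<in> A \<Longrightarrow> f i \<in> polys V) \<Longrightarrow> sum f A \<in> polys V"
  by (induction A rule: infinite_finite_induct) auto

lemma polys_prod [intro]: "(\<And>i. i \<in> A \<Longrightarrow> f i \<in> polys V) \<Longrightarrow> prod f A \<in> polys V"
  by (induction A rule: infinite_finite_induct) auto

lemma polys_single [intro]: "Poly_Mapping.keys m \<subseteq> V \<Longrightarrow> Poly_Mapping.single m c \<in> polys V"
  by (auto simp: polys_def split: if_splits)

lemma indet_in_polys [intro]: "v \<in> V \<Longrightarrow> indet v \<in> polys V"
  by (auto simp: indet_def intro!: polys_single)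

lemma poly_sum_monomials:
  "p = (\<Sum>m\<in>Poly_Mapping.keys p. Poly_Mapping.single m (Poly_Mapping.lookup p m))"
  by (rule poly_mapping_eqI)
    (simp add: lookup_sum lookup_single when_def sum.delta in_keys_iff)

lemma indet_power:
  "(indet v :: ('v \<Rightarrow>\<^sub>0 nat) \<Rightarrow>\<^sub>0 'k::comm_ring_1) ^ k = Poly_Mapping.single (Poly_Mapping.single v k) 1"
  by (induction k) (simp_all add: indet_def mult_single flip: single_add single_one)

text \<open>A monomial can be divided by any power of a variable that its exponent allows.\<close>

lemma monomial_divide_indet:
  assumes "k \<le> Poly_Mapping.lookup m v"
  shows "\<exists>m'. Poly_Mapping.keys m' \<subseteq> Poly_Mapping.keys m \<and>
    (Poly_Mapping.single m c :: ('v \<Rightarrow>\<^sub>0 nat) \<Rightarrow>\<^sub>0 'k::comm_ring_1) = indet v ^ k * Poly_Mapping.single m' c"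
proof -
  define m' where "m' = m - Poly_Mapping.single v k"
  have eq: "m = Poly_Mapping.single v k + m'"
    using assms by (intro poly_mapping_eqI)
      (auto simp: m'_def lookup_add lookup_minus lookup_single when_def)
  have "Poly_Mapping.keys m' \<subseteq> Poly_Mapping.keys m"
    by (auto simp: m'_def in_keys_iff lookup_minus)
  moreover have "Poly_Mapping.single m c = indet v ^ k * (Poly_Mapping.single m' c :: ('v \<Rightarrow>\<^sub>0 nat) \<Rightarrow>\<^sub>0 'k)"
    by (subst eq) (simp add: indet_power mult_single)
  ultimately show ?thesis by blast
qed

subsection \<open>Ideals of a polynomial ring\<close>

lemma ideal_mpoly_ring_iff:
  fixes J :: "(('v \<Rightarrow>\<^sub>0 nat) \<Rightarrow>\<^sub>0 'k::comm_ring_1) set"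
  shows "ideal J (mpoly_ring V) \<longleftrightarrow> J \<subseteq> polys V \<and> 0 \<in> J \<and> (\<forall>p\<in>J. \<forall>q\<in>J. p + q \<in> J) \<and>
    (\<forall>r\<in>polys V. \<forall>p\<in>J. r * p \<in> J)" (is "?L \<longleftrightarrow> ?R")
proof
  assume ?L
  then interpret ideal J "mpoly_ring V" .
  show ?R
    using a_subset additive_subgroup.zero_closed[OF is_additive_subgroup]
      additive_subgroup.a_closed[OF is_additive_subgroup] I_l_closed by auto
next
  assume R: ?R
  interpret cring "mpoly_ring V :: (('v \<Rightarrow>\<^sub>0 nat) \<Rightarrow>\<^sub>0 'k) ring"
    by (rule cring_mpoly_ring)
  have neg: "\<ominus>\<^bsub>mpoly_ring V\<^esub> p = - p" if "p \<in> polys V" for p :: "('v \<Rightarrow>\<^sub>0 nat) \<Rightarrow>\<^sub>0 'k"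
    using that by (intro minus_equality) auto
  have neg_J: "- p \<in> J" if "p \<in> J" for p
    using R that by (metis mult_minus1 polys_closed(2) polys_uminus)
  show ?L
  proof (rule idealI)
    show "subgroup J (add_monoid (mpoly_ring V))"
      using R neg neg_J by (intro add.subgroupI) (auto simp: a_inv_def)
    show "p \<otimes>\<^bsub>mpoly_ring V\<^esub> r \<in> J" if "p \<in> J" "r \<in> carrier (mpoly_ring V)" for p r
      using R that by (simp add: mult.commute[of p r])
  qed (use R in \<open>auto simp: ring_axioms\<close>)
qed

lemma
  fixes J :: "(('v \<Rightarrow>\<^sub>0 nat) \<Rightarrow>\<^sub>0 'k::comm_ring_1) set"
  assumes "ideal J (mpoly_ring V)"
  shows ideal_in_polys: "p \<in> J \<Longrightarrow> p \<in> polys V"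
    and ideal_zero: "0 \<in> J"
    and ideal_add: "p \<in> J \<Longrightarrow> q \<in> J \<Longrightarrow> p + q \<in> J"
    and ideal_mult: "r \<in> polys V \<Longrightarrow> p \<in> J \<Longrightarrow> r * p \<in> J"
    and ideal_mult_right: "r \<in> polys V \<Longrightarrow> p \<in> J \<Longrightarrow> p * r \<in> J"
  using assms by (auto simp: ideal_mpoly_ring_iff mult.commute)

lemma ideal_uminus:
  "ideal J (mpoly_ring V) \<Longrightarrow> p \<in> J \<Longrightarrow> - p \<in> (J :: (('v \<Rightarrow>\<^sub>0 nat) \<Rightarrow>\<^sub>0 'k::comm_ring_1) set)"
  using ideal_mult[of J V "- 1" p] by auto

lemma ideal_minus:
  "ideal J (mpoly_ring V) \<Longrightarrow> p \<in> J \<Longrightarrow> q \<in> J \<Longrightarrow> p - q \<in> (J :: (('v \<Rightarrow>\<^sub>0 nat) \<Rightarrow>\<^sub>0 'k::comm_ring_1) set)"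
  using ideal_add[of J V p "- q"] ideal_uminus[of J V q] by auto

lemma ideal_sum:
  fixes J :: "(('v \<Rightarrow>\<^sub>0 nat) \<Rightarrow>\<^sub>0 'k::comm_ring_1) set"
  assumes "ideal J (mpoly_ring V)" "\<And>i. i \<in> A \<Longrightarrow> f i \<in> J"
  shows "sum f A \<in> J"
  using assms(2)
  by (induction A rule: infinite_finite_induct)
    (auto intro: ideal_zero[OF assms(1)] ideal_add[OF assms(1)])

lemma primeideal_mpoly_ring_iff:
  fixes P :: "(('v \<Rightarrow>\<^sub>0 nat) \<Rightarrow>\<^sub>0 'k::comm_ring_1) set"
  shows "primeideal P (mpoly_ring V) \<longleftrightarrow> ideal P (mpoly_ring V) \<and> 1 \<notin> P \<and>
    (\<forall>p\<in>polys V. \<forall>q\<in>polys V. p * q \<in> P \<longrightarrow> p \<in> P \<or> q \<in> P)" (is "?L \<longleftrightarrow> ?R")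
proof
  assume ?L
  then interpret primeideal P "mpoly_ring V" .
  show ?R
    using is_ideal one_imp_carrier I_notcarr I_prime by auto
next
  assume R: ?R
  show ?L
    using R by (intro primeidealI cring_mpoly_ring) (auto simp: set_eq_iff)
qed

lemma
  fixes P :: "(('v \<Rightarrow>\<^sub>0 nat) \<Rightarrow>\<^sub>0 'k::comm_ring_1) set"
  assumes "primeideal P (mpoly_ring V)"
  shows prime_is_ideal: "ideal P (mpoly_ring V)"
    and prime_one: "1 \<notin> P"
    and prime_mult: "p * q \<in> P \<Longrightarrow> p \<in> polys V \<Longrightarrow> q \<in> polys V \<Longrightarrow> p \<in> P \<or> q \<in> P"
  using assms by (auto simp: primeideal_mpoly_ring_iff)

lemma prime_mult_iff:
  fixes P :: "(('v \<Rightarrow>\<^sub>0 nat) \<Rightarrow>\<^sub>0 'k::comm_ring_1) set"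
  assumes "primeideal P (mpoly_ring V)" "p \<in> polys V" "q \<in> polys V"
  shows "p * q \<in> P \<longleftrightarrow> p \<in> P \<or> q \<in> P"
  using assms prime_mult[OF assms(1), of p q] ideal_mult[OF prime_is_ideal[OF assms(1)], of p q]
    ideal_mult_right[OF prime_is_ideal[OF assms(1)], of q p] by blast

lemma prime_power:
  fixes P :: "(('v \<Rightarrow>\<^sub>0 nat) \<Rightarrow>\<^sub>0 'k::comm_ring_1) set"
  assumes "primeideal P (mpoly_ring V)" "p \<in> polys V" "p ^ k \<in> P"
  shows "p \<in> P"
  using assms(3)
proof (induction k)
  case 0
  then show ?case using prime_one[OF assms(1)] by simp
next
  case (Suc k)
  then show ?case using prime_mult[OF assms(1), of p "p ^ k"] assms(2) by auto
qed

lemma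
  fixes S :: "(('v \<Rightarrow>\<^sub>0 nat) \<Rightarrow>\<^sub>0 'k::comm_ring_1) set"
  assumes "S \<subseteq> polys V"
  shows ideal_Idl: "ideal (Idl\<^bsub>mpoly_ring V\<^esub> S) (mpoly_ring V)"
    and subset_Idl: "S \<subseteq> Idl\<^bsub>mpoly_ring V\<^esub> S"
proof -
  interpret cring "mpoly_ring V :: (('v \<Rightarrow>\<^sub>0 nat) \<Rightarrow>\<^sub>0 'k) ring"
    by (rule cring_mpoly_ring)
  show "ideal (Idl\<^bsub>mpoly_ring V\<^esub> S) (mpoly_ring V)" "S \<subseteq> Idl\<^bsub>mpoly_ring V\<^esub> S"
    using assms genideal_ideal[of S] genideal_self[of S] by simp_all
qed

lemma Idl_subset:
  fixes S :: "(('v \<Rightarrow>\<^sub>0 nat) \<Rightarrow>\<^sub>0 'k::comm_ring_1) set"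
  assumes "ideal J (mpoly_ring V)" "S \<subseteq> J"
  shows "Idl\<^bsub>mpoly_ring V\<^esub> S \<subseteq> J"
  using ring.genideal_minimal[OF cring.axioms(1)[OF cring_mpoly_ring] assms] .

lemma Idl_list_combination:
  fixes as :: "(('v \<Rightarrow>\<^sub>0 nat) \<Rightarrow>\<^sub>0 'k::comm_ring_1) list"
  assumes as: "set as \<subseteq> polys Z" and p: "p \<in> Idl\<^bsub>mpoly_ring Z\<^esub> (set as)"
  obtains g where "p = (\<Sum>i<length as. as ! i * g i)"
proof -
  let ?J = "{p. \<exists>g. (\<forall>i. g i \<in> polys Z) \<and> p = (\<Sum>i<length as. as ! i * g i)}"
  have "ideal ?J (mpoly_ring Z)"
    unfolding ideal_mpoly_ring_iff
  proof (intro conjI ballI)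
    have "as ! i \<in> polys Z" if "i < length as" for i
      using as nth_mem[OF that] by blast
    then show "?J \<subseteq> polys Z" by (auto intro!: polys_sum)
    show "0 \<in> ?J" by (auto intro!: exI[of _ "\<lambda>_. 0"])
  next
    fix p q assume "p \<in> ?J" "q \<in> ?J"
    then obtain g h where "\<forall>i. g i \<in> polys Z" "p = (\<Sum>i<length as. as ! i * g i)"
      "\<forall>i. h i \<in> polys Z" "q = (\<Sum>i<length as. as ! i * h i)" by blast
    then show "p + q \<in> ?J"
      by (intro CollectI exI[of _ "\<lambda>i. g i + h i"]) (simp add: distrib_left sum.distrib)
  next
    fix r p :: "('v \<Rightarrow>\<^sub>0 nat) \<Rightarrow>\<^sub>0 'k"
    assume r: "r \<in> polys Z" and "p \<in> ?J"
    then obtain g where "\<forall>i. g i \<in> polys Z" "p = (\<Sum>i<length as. as ! i * g i)" by blast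
    then show "r * p \<in> ?J"
      using r by (intro CollectI exI[of _ "\<lambda>i. r * g i"]) (auto simp: sum_distrib_left ac_simps)
  qed
  moreover have "set as \<subseteq> ?J"
  proof
    fix a assume "a \<in> set as"
    then obtain i where i: "i < length as" "a = as ! i" by (auto simp: in_set_conv_nth)
    have "a = (\<Sum>j<length as. if j = i then as ! j else 0)"
      using i by (simp add: sum.delta)
    also have "\<dots> = (\<Sum>j<length as. as ! j * (if j = i then 1 else 0))"
      by (intro sum.cong) auto
    finally show "a \<in> ?J"
      by (intro CollectI exI[of _ "\<lambda>j. if j = i then 1 else 0"]) auto
  qed
  ultimately show ?thesis using Idl_subset p that by blast
qed

text \<open>The radical is an ideal: in the binomial expansion of \<open>(p + q) ^ (a + b)\<close> every term
  contains \<open>p ^ a\<close> or \<open>q ^ b\<close>.\<close>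

lemma ideal_radical:
  fixes J :: "(('v \<Rightarrow>\<^sub>0 nat) \<Rightarrow>\<^sub>0 'k::comm_ring_1) set"
  assumes J: "ideal J (mpoly_ring V)"
  shows "ideal (radical (mpoly_ring V) J) (mpoly_ring V)"
  unfolding ideal_mpoly_ring_iff
proof (intro conjI ballI)
  show "radical (mpoly_ring V) J \<subseteq> polys V"
    by (auto simp: radical_def)
  show "0 \<in> radical (mpoly_ring V) J"
    using ideal_zero[OF J] by (auto simp: radical_def intro!: exI[of _ 1])
next
  fix p q assume "p \<in> radical (mpoly_ring V) J" "q \<in> radical (mpoly_ring V) J"
  then obtain a b where pq: "p \<in> polys V" "q \<in> polys V" and ab: "p ^ a \<in> J" "q ^ b \<in> J"
    by (auto simp: radical_def)
  have "(p + q) ^ (a + b) = (\<Sum>k\<le>a + b. of_nat (a + b choose k) * p ^ k * q ^ (a + b - k))"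
    by (rule binomial_ring)
  also have "\<dots> \<in> J"
  proof (rule ideal_sum[OF J])
    fix k assume k: "k \<in> {..a + b}"
    have of_nat: "of_nat l \<in> (polys V :: (('v \<Rightarrow>\<^sub>0 nat) \<Rightarrow>\<^sub>0 'k) set)" for l
      by (induction l) auto
    show "of_nat (a + b choose k) * p ^ k * q ^ (a + b - k) \<in> J"
    proof (cases "a \<le> k")
      case True
      have "of_nat (a + b choose k) * p ^ k * q ^ (a + b - k) =
          (of_nat (a + b choose k) * p ^ (k - a) * q ^ (a + b - k)) * p ^ a"
        using True power_add[of p "k - a" a] by (simp add: ac_simps)
      then show ?thesis using ideal_mult[OF J] of_nat pq ab by auto
    next
      case False
      then have "a + b - k = (a - k) + b" by simp
      then have "of_nat (a + b choose k) * p ^ k * q ^ (a + b - k) =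
          (of_nat (a + b choose k) * p ^ k * q ^ (a - k)) * q ^ b"
        by (simp add: power_add ac_simps)
      then show ?thesis using ideal_mult[OF J] of_nat pq ab by auto
    qed
  qed
  finally show "p + q \<in> radical (mpoly_ring V) J"
    using pq by (auto simp: radical_def)
next
  fix r p :: "('v \<Rightarrow>\<^sub>0 nat) \<Rightarrow>\<^sub>0 'k"
  assume r: "r \<in> polys V" and "p \<in> radical (mpoly_ring V) J"
  then obtain a where "p \<in> polys V" "p ^ a \<in> J" by (auto simp: radical_def)
  then show "r * p \<in> radical (mpoly_ring V) J"
    using r ideal_mult[OF J, of "r ^ a" "p ^ a"] by (auto simp: radical_def power_mult_distrib)
qed

lemma radical_member: "p \<in> polys V \<Longrightarrow> p ^ k \<in> J \<Longrightarrow> p \<in> radical (mpoly_ring V) J"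
  by (auto simp: radical_def)

lemma radical_idem:
  assumes "p \<in> polys V" "p ^ k \<in> radical (mpoly_ring V) J"
  shows "p \<in> radical (mpoly_ring V) J"
  using assms by (auto simp: radical_def simp flip: power_mult)

lemma subset_radical: "J \<subseteq> polys V \<Longrightarrow> J \<subseteq> radical (mpoly_ring V) J"
  by (auto intro: radical_member[where k = 1])

lemma radical_mono_ideal:
  fixes J :: "(('v \<Rightarrow>\<^sub>0 nat) \<Rightarrow>\<^sub>0 'k::comm_ring_1) set"
  assumes "A \<subseteq> radical (mpoly_ring V) J" "J \<subseteq> polys V"
  shows "radical (mpoly_ring V) A \<subseteq> radical (mpoly_ring V) J"
  using assms by (fastforce simp: radical_def simp flip: power_mult)

section \<open>Primes generated by variables\<close>

definition var_prime :: "'v set \<Rightarrow> 'v set \<Rightarrow> (('v \<Rightarrow>\<^sub>0 nat) \<Rightarrow>\<^sub>0 'k::comm_ring_1) set" where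
  "var_prime V C = {p \<in> polys V. \<forall>m\<in>Poly_Mapping.keys p. Poly_Mapping.keys m \<inter> C \<noteq> {}}"

lemma keys_add_nat:
  "Poly_Mapping.keys (a + b :: 'v \<Rightarrow>\<^sub>0 nat) = Poly_Mapping.keys a \<union> Poly_Mapping.keys b"
  by (auto simp: in_keys_iff lookup_add)

text \<open>The polynomial ring has no monomial order at hand, since the type of variables carries no order.
  What the proofs below need of a leading monomial is only that its exponent arises in one way as a
  sum. Such exponents are found by passing, for one variable after another, to the elements of maximal
  exponent in that variable: a sum of two maxima is not a sum of elements one of which is smaller.\<close>

lemma finite_unique_sum:
  fixes A B :: "('v \<Rightarrow>\<^sub>0 nat) set"
  assumes "finite X" "finite A" "finite B" "A \<noteq> {}" "B \<noteq> {}"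
  shows "\<exists>A0 B0. A0 \<subseteq> A \<and> B0 \<subseteq> B \<and> A0 \<noteq> {} \<and> B0 \<noteq> {} \<and>
    (\<forall>v\<in>X. (\<forall>a\<in>A0. \<forall>a'\<in>A0. Poly_Mapping.lookup a v = Poly_Mapping.lookup a' v) \<and>
            (\<forall>b\<in>B0. \<forall>b'\<in>B0. Poly_Mapping.lookup b v = Poly_Mapping.lookup b' v)) \<and>
    (\<forall>a\<in>A0. \<forall>b\<in>B0. \<forall>a'\<in>A. \<forall>b'\<in>B. a' + b' = a + b \<longrightarrow> a' \<in> A0 \<and> b' \<in> B0)"
  using assms(1)
proof (induction X rule: finite_induct)
  case empty
  show ?case using assms by (intro exI[of _ A] exI[of _ B]) auto
next
  case (insert x X)
  then obtain A0 B0 where sub: "A0 \<subseteq> A" "B0 \<subseteq> B" and ne: "A0 \<noteq> {}" "B0 \<noteq> {}" and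
    agree: "\<forall>v\<in>X. (\<forall>a\<in>A0. \<forall>a'\<in>A0. Poly_Mapping.lookup a v = Poly_Mapping.lookup a' v) \<and>
      (\<forall>b\<in>B0. \<forall>b'\<in>B0. Poly_Mapping.lookup b v = Poly_Mapping.lookup b' v)" and
    closed: "\<forall>a\<in>A0. \<forall>b\<in>B0. \<forall>a'\<in>A. \<forall>b'\<in>B. a' + b' = a + b \<longrightarrow> a' \<in> A0 \<and> b' \<in> B0"
    by blast
  let ?e = "\<lambda>a. Poly_Mapping.lookup a x"
  define A1 where "A1 = {a\<in>A0. ?e a = Max (?e ` A0)}"
  define B1 where "B1 = {b\<in>B0. ?e b = Max (?e ` B0)}"
  have fin: "finite (?e ` A0)" "finite (?e ` B0)"
    using sub assms finite_subset by blast+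
  have "Max (?e ` A0) \<in> ?e ` A0" "Max (?e ` B0) \<in> ?e ` B0"
    using fin ne by (auto intro: Max_in)
  then have ne1: "A1 \<noteq> {}" "B1 \<noteq> {}" by (auto simp: A1_def B1_def)
  have "a' \<in> A1 \<and> b' \<in> B1"
    if "a \<in> A1" "b \<in> B1" "a' \<in> A" "b' \<in> B" and eq: "a' + b' = a + b" for a b a' b'
  proof -
    have in0: "a' \<in> A0" "b' \<in> B0"
      using closed that unfolding A1_def B1_def by blast+
    then have "?e a' \<le> ?e a" "?e b' \<le> ?e b"
      using that(1,2) fin by (auto simp: A1_def B1_def)
    moreover have "?e a' + ?e b' = ?e a + ?e b"
      using arg_cong[OF eq, of "\<lambda>m. Poly_Mapping.lookup m x"] by (simp add: lookup_add)
    ultimately show ?thesis using in0 that(1,2) by (auto simp: A1_def B1_def)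
  qed
  moreover have "\<forall>v\<in>insert x X. (\<forall>a\<in>A1. \<forall>a'\<in>A1. Poly_Mapping.lookup a v = Poly_Mapping.lookup a' v) \<and>
      (\<forall>b\<in>B1. \<forall>b'\<in>B1. Poly_Mapping.lookup b v = Poly_Mapping.lookup b' v)"
    using agree by (auto simp: A1_def B1_def)
  moreover have "A1 \<subseteq> A" "B1 \<subseteq> B" using sub by (auto simp: A1_def B1_def)
  ultimately show ?case using ne1 by blast
qed

lemma unique_sum:
  fixes A B :: "('v \<Rightarrow>\<^sub>0 nat) set"
  assumes "finite A" "finite B" "A \<noteq> {}" "B \<noteq> {}"
  obtains a b where "a \<in> A" "b \<in> B"
    "\<And>a' b'. a' \<in> A \<Longrightarrow> b' \<in> B \<Longrightarrow> a' + b' = a + b \<Longrightarrow> a' = a \<and> b' = b"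
proof -
  define X where "X = (\<Union>m\<in>A \<union> B. Poly_Mapping.keys m)"
  have "finite X" using assms by (auto simp: X_def)
  from finite_unique_sum[OF this assms] obtain A0 B0 where
    sub: "A0 \<subseteq> A" "B0 \<subseteq> B" and ne: "A0 \<noteq> {}" "B0 \<noteq> {}" and
    agree: "\<forall>v\<in>X. (\<forall>a\<in>A0. \<forall>a'\<in>A0. Poly_Mapping.lookup a v = Poly_Mapping.lookup a' v) \<and>
      (\<forall>b\<in>B0. \<forall>b'\<in>B0. Poly_Mapping.lookup b v = Poly_Mapping.lookup b' v)" and
    closed: "\<forall>a\<in>A0. \<forall>b\<in>B0. \<forall>a'\<in>A. \<forall>b'\<in>B. a' + b' = a + b \<longrightarrow> a' \<in> A0 \<and> b' \<in> B0"
    by blast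
  have outside: "Poly_Mapping.lookup m v = 0" if "m \<in> A \<union> B" "v \<notin> X" for m v
    using that by (auto simp: X_def in_keys_iff)
  have eqA: "a = a'" if "a \<in> A0" "a' \<in> A0" for a a'
    using that agree outside sub by (intro poly_mapping_eqI) (metis UnI1 subsetD)
  have eqB: "b = b'" if "b \<in> B0" "b' \<in> B0" for b b'
    using that agree outside sub by (intro poly_mapping_eqI) (metis UnI2 subsetD)
  from ne obtain a b where "a \<in> A0" "b \<in> B0" by blast
  show ?thesis
    using that[of a b] \<open>a \<in> A0\<close> \<open>b \<in> B0\<close> sub closed eqA eqB by blast
qed

lemma mult_sum_monomials:
  fixes p q :: "('v \<Rightarrow>\<^sub>0 nat) \<Rightarrow>\<^sub>0 'k::comm_ring_1"
  shows "p * q = (\<Sum>a\<in>Poly_Mapping.keys p. \<Sum>b\<in>Poly_Mapping.keys q.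
    Poly_Mapping.single (a + b) (Poly_Mapping.lookup p a * Poly_Mapping.lookup q b))"
proof -
  have "p * q = (\<Sum>a\<in>Poly_Mapping.keys p. Poly_Mapping.single a (Poly_Mapping.lookup p a)) *
      (\<Sum>b\<in>Poly_Mapping.keys q. Poly_Mapping.single b (Poly_Mapping.lookup q b))"
    using poly_sum_monomials[of p] poly_sum_monomials[of q] by simp
  then show ?thesis by (simp add: sum_product mult_single)
qed

lemma lookup_mult_unique:
  fixes p q :: "('v \<Rightarrow>\<^sub>0 nat) \<Rightarrow>\<^sub>0 'k::comm_ring_1"
  assumes "\<And>a' b'. a' \<in> Poly_Mapping.keys p \<Longrightarrow> b' \<in> Poly_Mapping.keys q \<Longrightarrow> a' + b' = a + b \<Longrightarrow> a' = a \<and> b' = b"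
    and "a \<in> Poly_Mapping.keys p" "b \<in> Poly_Mapping.keys q"
  shows "Poly_Mapping.lookup (p * q) (a + b) = Poly_Mapping.lookup p a * Poly_Mapping.lookup q b"
proof -
  have "Poly_Mapping.lookup (p * q) (a + b) = (\<Sum>a'\<in>Poly_Mapping.keys p. \<Sum>b'\<in>Poly_Mapping.keys q.
      Poly_Mapping.lookup p a' * Poly_Mapping.lookup q b' when a' + b' = a + b)"
    by (subst mult_sum_monomials) (simp add: lookup_sum lookup_single)
  also have "\<dots> = (\<Sum>a'\<in>Poly_Mapping.keys p. \<Sum>b'\<in>Poly_Mapping.keys q.
      if b' = b then (if a' = a then Poly_Mapping.lookup p a * Poly_Mapping.lookup q b else 0) else 0)"
    using assms(1) by (intro sum.cong refl) (auto simp: when_def)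
  also have "\<dots> = Poly_Mapping.lookup p a * Poly_Mapping.lookup q b"
    using assms(2,3) by (simp add: sum.delta)
  finally show ?thesis .
qed

lemma ideal_var_prime:
  "ideal (var_prime V C :: (('v \<Rightarrow>\<^sub>0 nat) \<Rightarrow>\<^sub>0 'k::comm_ring_1) set) (mpoly_ring V)"
  unfolding ideal_mpoly_ring_iff
proof (intro conjI ballI)
  show "p + q \<in> var_prime V C" if "p \<in> var_prime V C" "q \<in> var_prime V C"
    for p q :: "('v \<Rightarrow>\<^sub>0 nat) \<Rightarrow>\<^sub>0 'k"
    using that Poly_Mapping.keys_add[of p q] by (auto simp: var_prime_def)
  show "r * p \<in> var_prime V C" if "r \<in> polys V" "p \<in> var_prime V C"
    for r p :: "('v \<Rightarrow>\<^sub>0 nat) \<Rightarrow>\<^sub>0 'k"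
    using that keys_mult[of r p] by (fastforce simp: var_prime_def keys_add_nat)
qed (auto simp: var_prime_def)

text \<open>Among the monomials of \<open>p\<close> and of \<open>q\<close> that avoid \<open>C\<close>, choose a pair with a unique sum.
  Factors of a monomial avoiding \<open>C\<close> avoid \<open>C\<close>, so this sum is not hit by the other monomials of
  \<open>p\<close> and \<open>q\<close> either, and its coefficient in \<open>p * q\<close> does not cancel.\<close>

lemma prime_var_prime:
  "primeideal (var_prime V C :: (('v \<Rightarrow>\<^sub>0 nat) \<Rightarrow>\<^sub>0 'k::idom) set) (mpoly_ring V)"
  unfolding primeideal_mpoly_ring_iff
proof (intro conjI ballI impI ideal_var_prime)
  show "(1 :: ('v \<Rightarrow>\<^sub>0 nat) \<Rightarrow>\<^sub>0 'k) \<notin> var_prime V C"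
    by (simp add: var_prime_def)
next
  fix p q :: "('v \<Rightarrow>\<^sub>0 nat) \<Rightarrow>\<^sub>0 'k"
  assume pq: "p \<in> polys V" "q \<in> polys V" and prod: "p * q \<in> var_prime V C"
  show "p \<in> var_prime V C \<or> q \<in> var_prime V C"
  proof (rule ccontr)
    define av where "av f = {m \<in> Poly_Mapping.keys f. Poly_Mapping.keys m \<inter> C = {}}"
      for f :: "('v \<Rightarrow>\<^sub>0 nat) \<Rightarrow>\<^sub>0 'k"
    assume "\<not> ?thesis"
    then have "av p \<noteq> {}" "av q \<noteq> {}" using pq by (auto simp: var_prime_def av_def)
    moreover have fin: "finite (av f)" for f by (simp add: av_def)
    ultimately obtain a b where ab: "a \<in> av p" "b \<in> av q" and
      uniq: "\<And>a' b'. a' \<in> av p \<Longrightarrow> b' \<in> av q \<Longrightarrow> a' + b' = a + b \<Longrightarrow> a' = a \<and> b' = b"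
      using unique_sum[of "av p" "av q"] fin by metis
    have "a' = a \<and> b' = b"
      if "a' \<in> Poly_Mapping.keys p" "b' \<in> Poly_Mapping.keys q" "a' + b' = a + b" for a' b'
    proof -
      have "Poly_Mapping.keys (a' + b') \<inter> C = {}"
        using ab that(3) by (auto simp: av_def keys_add_nat)
      then have "a' \<in> av p" "b' \<in> av q"
        using that unfolding av_def keys_add_nat by blast+
      then show ?thesis using that(3) uniq by blast
    qed
    then have "Poly_Mapping.lookup (p * q) (a + b) = Poly_Mapping.lookup p a * Poly_Mapping.lookup q b"
      using ab by (intro lookup_mult_unique) (auto simp: av_def)
    then have "a + b \<in> Poly_Mapping.keys (p * q)"
      using ab by (auto simp: av_def in_keys_iff)
    then have "Poly_Mapping.keys (a + b) \<inter> C \<noteq> {}"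
      using prod unfolding var_prime_def by blast
    then show False
      using ab by (auto simp: av_def keys_add_nat)
  qed
qed

lemma indet_in_var_prime:
  "v \<in> V \<Longrightarrow> indet v \<in> (var_prime V C :: (('v \<Rightarrow>\<^sub>0 nat) \<Rightarrow>\<^sub>0 'k::comm_ring_1) set) \<longleftrightarrow> v \<in> C"
  by (auto simp: var_prime_def indet_in_polys) (auto simp: indet_def)

lemma var_prime_subset:
  fixes J :: "(('v \<Rightarrow>\<^sub>0 nat) \<Rightarrow>\<^sub>0 'k::comm_ring_1) set"
  assumes J: "ideal J (mpoly_ring V)" and C: "\<And>v. v \<in> C \<inter> V \<Longrightarrow> indet v \<in> J"
  shows "var_prime V C \<subseteq> J"
proof
  fix p :: "('v \<Rightarrow>\<^sub>0 nat) \<Rightarrow>\<^sub>0 'k"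
  assume p: "p \<in> var_prime V C"
  have "Poly_Mapping.single m (Poly_Mapping.lookup p m) \<in> J" if m: "m \<in> Poly_Mapping.keys p" for m
  proof -
    from p m obtain v where v: "v \<in> C" "v \<in> Poly_Mapping.keys m" and mV: "Poly_Mapping.keys m \<subseteq> V"
      unfolding var_prime_def polys_def by blast
    from v have "1 \<le> Poly_Mapping.lookup m v" by (simp add: in_keys_iff)
    from monomial_divide_indet[OF this] obtain m' where m': "Poly_Mapping.keys m' \<subseteq> Poly_Mapping.keys m"
      "Poly_Mapping.single m (Poly_Mapping.lookup p m) =
        indet v ^ 1 * Poly_Mapping.single m' (Poly_Mapping.lookup p m)" by blast
    then show ?thesis
      using C[of v] v mV ideal_mult_right[OF J polys_single[of m' V]]
      by (metis IntI order_trans power_one_right subsetD)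
  qed
  then show "p \<in> J" by (subst poly_sum_monomials) (rule ideal_sum[OF J])
qed

text \<open>Adjoining the variables of \<open>C\<close> one at a time gives a chain of primes.\<close>

lemma prime_height_ge_card:
  fixes P :: "(('v \<Rightarrow>\<^sub>0 nat) \<Rightarrow>\<^sub>0 'k::idom) set"
  assumes "primeideal P (mpoly_ring V)" "finite C" "C \<subseteq> V" "\<And>v. v \<in> C \<Longrightarrow> indet v \<in> P"
  shows "enat (card C) \<le> prime_height (mpoly_ring V) P"
proof -
  obtain xs where xs: "set xs = C" "distinct xs" using finite_distinct_list[OF assms(2)] by blast
  \<comment> \<open>\<open>P\<close> may be larger than \<open>var_prime V C\<close>, so it takes the place of that prime at the top.\<close>
  define D where "D i = (if i < card C then var_prime V (set (take i xs)) else P)" for i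
  have len: "length xs = card C" using xs distinct_card by fastforce
  have "D i \<subset> D (Suc i)" if i: "i < card C" for i
  proof -
    have x: "xs ! i \<in> C" "xs ! i \<notin> set (take i xs)" "xs ! i \<in> V"
      using i len xs assms(3) by (auto simp: set_conv_nth nth_eq_iff_index_eq)
    have sub: "set (take j xs) \<subseteq> C" for j using xs set_take_subset[of j xs] by auto
    show ?thesis
    proof (cases "Suc i < card C")
      case True
      have "xs ! i \<in> set (take (Suc i) xs)" using i len by (simp add: take_Suc_conv_app_nth)
      moreover have "var_prime V (set (take i xs)) \<subseteq> (var_prime V (set (take (Suc i) xs)) :: (('v \<Rightarrow>\<^sub>0 nat) \<Rightarrow>\<^sub>0 'k) set)"
        using set_take_subset_set_take[of i "Suc i" xs] by (auto simp: var_prime_def)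
      ultimately show ?thesis
        using x True i indet_in_var_prime[of "xs ! i" V] unfolding D_def by auto
    next
      case False
      have "var_prime V (set (take i xs)) \<subseteq> P"
        using sub assms(4) by (intro var_prime_subset prime_is_ideal assms(1)) auto
      then show ?thesis
        using x False i assms(4) indet_in_var_prime[of "xs ! i" V] unfolding D_def by auto
    qed
  qed
  moreover have "primeideal (D i) (mpoly_ring V)" for i
    using assms(1) prime_var_prime by (auto simp: D_def)
  moreover have "D (card C) = P" by (simp add: D_def)
  ultimately show ?thesis
    unfolding prime_height_def by (intro SUP_upper) blast
qed

section \<open>Counting dimensions\<close>

definition scalar :: "'k::comm_ring_1 \<Rightarrow> (('v \<Rightarrow>\<^sub>0 nat) \<Rightarrow>\<^sub>0 'k) \<Rightarrow> (('v \<Rightarrow>\<^sub>0 nat) \<Rightarrow>\<^sub>0 'k)" where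
  "scalar c p = Poly_Mapping.single 0 c * p"

lemma scalar_simps [simp]: "scalar 0 p = 0" "scalar 1 p = p" "scalar (- 1) p = - p"
  by (simp_all add: scalar_def single_uminus)

lemma scalar_single [simp]: "scalar c (Poly_Mapping.single m d) = Poly_Mapping.single m (c * d)"
  by (simp add: scalar_def mult_single)

lemma scalar_mult: "p * scalar c q = scalar c (p * q)" "scalar c q * p = scalar c (q * p)"
  by (simp_all add: scalar_def ac_simps)

lemma scalar_in_polys [intro]: "p \<in> polys V \<Longrightarrow> scalar c p \<in> polys V"
  by (auto simp: scalar_def intro!: polys_single)

interpretation poly_vs: vector_space "scalar :: 'k::field \<Rightarrow> (('v \<Rightarrow>\<^sub>0 nat) \<Rightarrow>\<^sub>0 'k) \<Rightarrow> _"
  by unfold_locales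
    (simp_all add: scalar_def distrib_left distrib_right single_add mult_single mult.assoc [symmetric])

text \<open>Bounding every exponent separately, instead of the total degree, makes the number of monomials
  an exact power.\<close>

definition exponent_box :: "'v set \<Rightarrow> nat \<Rightarrow> ('v \<Rightarrow>\<^sub>0 nat) set" where
  "exponent_box X N = {m. Poly_Mapping.keys m \<subseteq> X \<and> (\<forall>v. Poly_Mapping.lookup m v \<le> N)}"

lemma card_exponent_box:
  fixes X :: "'v set"
  assumes "finite X"
  shows "finite (exponent_box X N) \<and> card (exponent_box X N) = (N + 1) ^ card X"
proof -
  let ?g = "\<lambda>f. Abs_poly_mapping (\<lambda>v. if v \<in> X then f v else (0::nat))"
  have "bij_betw (\<lambda>m. restrict (Poly_Mapping.lookup m) X) (exponent_box X N) (X \<rightarrow>\<^sub>E {..N})"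
  proof (rule bij_betwI[where g = ?g])
    have fin: "finite {v. (if v \<in> X then f v else (0::nat)) \<noteq> 0}" for f
      using assms by (rule finite_subset[rotated]) auto
    show "?g \<in> (X \<rightarrow>\<^sub>E {..N}) \<rightarrow> exponent_box X N"
      using fin by (auto simp: exponent_box_def in_keys_iff split: if_splits)
    show "restrict (Poly_Mapping.lookup (?g f)) X = f" if "f \<in> X \<rightarrow>\<^sub>E {..N}" for f
      using that fin by (auto simp: fun_eq_iff restrict_def PiE_def extensional_def)
    show "(\<lambda>m. restrict (Poly_Mapping.lookup m) X) \<in> exponent_box X N \<rightarrow> (X \<rightarrow>\<^sub>E {..N})"
      by (auto simp: exponent_box_def)
    show "?g (restrict (Poly_Mapping.lookup m) X) = m" if "m \<in> exponent_box X N" for m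
    proof -
      have "(\<lambda>v. if v \<in> X then restrict (Poly_Mapping.lookup m) X v else 0) = Poly_Mapping.lookup m"
        using that by (auto simp: fun_eq_iff exponent_box_def in_keys_iff)
      then show ?thesis by (simp add: lookup_inverse)
    qed
  qed
  moreover have "finite (X \<rightarrow>\<^sub>E {..N})" "card (X \<rightarrow>\<^sub>E {..N}) = (N + 1) ^ card X"
    using assms by (auto simp: card_PiE finite_PiE)
  ultimately show ?thesis
    using bij_betw_finite bij_betw_same_card by metis
qed

lemma exponent_box_add:
  assumes "a \<in> exponent_box X M" "b \<in> exponent_box X N"
  shows "a + b \<in> exponent_box X (M + N)"
  using assms by (auto simp: exponent_box_def keys_add_nat lookup_add intro: add_mono)

lemma exponent_box_mono: "M \<le> N \<Longrightarrow> exponent_box X M \<subseteq> exponent_box X N"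
  by (auto simp: exponent_box_def intro: order_trans)

definition box_polys :: "'v set \<Rightarrow> nat \<Rightarrow> (('v \<Rightarrow>\<^sub>0 nat) \<Rightarrow>\<^sub>0 'k::comm_ring_1) set" where
  "box_polys X N = {p. Poly_Mapping.keys p \<subseteq> exponent_box X N}"

lemma box_polys_mult:
  assumes "p \<in> box_polys X M" "q \<in> box_polys X N"
  shows "p * q \<in> box_polys X (M + N)"
  using assms keys_mult[of p q] exponent_box_add by (force simp: box_polys_def)

lemma box_polys_mono: "M \<le> N \<Longrightarrow> box_polys X M \<subseteq> box_polys X N"
  using exponent_box_mono unfolding box_polys_def by blast

lemma box_polys_power:
  "p \<in> box_polys X M \<Longrightarrow> (p ^ j :: ('v \<Rightarrow>\<^sub>0 nat) \<Rightarrow>\<^sub>0 'k::comm_ring_1) \<in> box_polys X (j * M)"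
proof (induction j)
  case 0
  then show ?case by (simp add: box_polys_def exponent_box_def)
next
  case (Suc j)
  then show ?case using box_polys_mult[of p X M "p ^ j" "j * M"] by (simp add: add.commute)
qed

lemma polys_in_box:
  assumes "p \<in> polys X"
  shows "\<exists>M. p \<in> box_polys X M"
proof -
  define S where "S = (\<Union>m\<in>Poly_Mapping.keys p. Poly_Mapping.lookup m ` Poly_Mapping.keys m)"
  have fin: "finite S" by (auto simp: S_def)
  have "Poly_Mapping.lookup m v \<le> Max (insert 0 S)" if "m \<in> Poly_Mapping.keys p" for m v
  proof (cases "v \<in> Poly_Mapping.keys m")
    case True
    then have "Poly_Mapping.lookup m v \<in> S" using that by (auto simp: S_def)
    then show ?thesis using fin by (intro Max_ge) auto
  qed (simp add: in_keys_iff)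
  then have "p \<in> box_polys X (Max (insert 0 S))"
    using assms by (auto simp: box_polys_def exponent_box_def polys_def)
  then show ?thesis ..
qed

lemma box_polys_subset_polys: "box_polys X M \<subseteq> polys X"
  by (auto simp: box_polys_def polys_def exponent_box_def)

lemma span_monomials:
  fixes p :: "('v \<Rightarrow>\<^sub>0 nat) \<Rightarrow>\<^sub>0 'k::field"
  assumes "Poly_Mapping.keys p \<subseteq> B"
  shows "p \<in> poly_vs.span ((\<lambda>m. Poly_Mapping.single m 1) ` B)"
proof -
  have "(\<Sum>m\<in>Poly_Mapping.keys p. scalar (Poly_Mapping.lookup p m) (Poly_Mapping.single m 1))
      \<in> poly_vs.span ((\<lambda>m. Poly_Mapping.single m 1) ` B)"
    using assms by (intro poly_vs.span_sum poly_vs.span_scale poly_vs.span_base) auto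
  then show ?thesis by (simp flip: poly_sum_monomials)
qed

section \<open>Linear independence modulo a prime\<close>

definition indep_mod :: "(('v \<Rightarrow>\<^sub>0 nat) \<Rightarrow>\<^sub>0 'k::field) set \<Rightarrow> (('v \<Rightarrow>\<^sub>0 nat) \<Rightarrow>\<^sub>0 'k) set \<Rightarrow> bool" where
  "indep_mod Q S \<longleftrightarrow> finite S \<and> (\<forall>c. (\<Sum>b\<in>S. scalar (c b) b) \<in> Q \<longrightarrow> (\<forall>b\<in>S. c b = 0))"

text \<open>An independent family has no repetitions, since \<open>b i = b j\<close> would be the linear relation
  \<open>b i - b j = 0\<close>. So it can be replaced by the set of its members, which has as many elements as the index set.\<close>

lemma indep_mod_family:
  fixes Q :: "(('v \<Rightarrow>\<^sub>0 nat) \<Rightarrow>\<^sub>0 'k::field) set"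
  assumes "finite A" "0 \<in> Q"
    and indep: "\<And>c i. (\<Sum>i\<in>A. scalar (c i) (b i)) \<in> Q \<Longrightarrow> i \<in> A \<Longrightarrow> c i = 0"
  shows "inj_on b A" "indep_mod Q (b ` A)"
proof -
  show inj: "inj_on b A"
  proof (rule inj_onI, rule ccontr)
    fix i j assume ij: "i \<in> A" "j \<in> A" "b i = b j" "i \<noteq> j"
    define c where "c k = (if k = i then 1 else if k = j then -1 else 0 :: 'k)" for k
    have "(\<Sum>k\<in>A. scalar (c k) (b k)) = (\<Sum>k\<in>A. (if k = i then b i else 0) + (if k = j then - b i else 0))"
      using ij by (intro sum.cong) (auto simp: c_def)
    also have "\<dots> = 0" using ij assms(1) by (simp add: sum.distrib)
    finally show False using indep[of c i] ij assms(2) by (simp add: c_def)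
  qed
  show "indep_mod Q (b ` A)"
    unfolding indep_mod_def
  proof (intro conjI allI impI ballI)
    fix c x assume sum: "(\<Sum>x\<in>b ` A. scalar (c x) x) \<in> Q" and "x \<in> b ` A"
    then obtain i where i: "i \<in> A" "x = b i" by blast
    have "(\<Sum>i\<in>A. scalar (c (b i)) (b i)) \<in> Q"
      using sum inj by (simp add: sum.reindex)
    from indep[OF this i(1)] show "c x = 0" using i by simp
  qed (use assms in auto)
qed

lemma indep_mod_card_le_span:
  fixes Q :: "(('v \<Rightarrow>\<^sub>0 nat) \<Rightarrow>\<^sub>0 'k::field) set"
  assumes "indep_mod Q S" "0 \<in> Q" "finite T" "S \<subseteq> poly_vs.span T"
  shows "card S \<le> card T"
proof -
  have "finite S" using assms(1) by (simp add: indep_mod_def)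
  then have "poly_vs.independent S"
    using assms(1,2) by (auto simp: indep_mod_def poly_vs.dependent_finite)
  then show ?thesis
    using poly_vs.independent_span_bound[OF assms(3) _ assms(4)] by blast
qed

lemma indep_mod_card_le:
  fixes Q :: "(('v \<Rightarrow>\<^sub>0 nat) \<Rightarrow>\<^sub>0 'k::field) set"
  assumes "indep_mod Q S" "0 \<in> Q" "S \<subseteq> box_polys X M" "finite X"
  shows "card S \<le> (M + 1) ^ card X"
proof -
  let ?T = "(\<lambda>m. Poly_Mapping.single m (1::'k)) ` exponent_box X M"
  have fin: "finite (exponent_box X M)" using card_exponent_box assms(4) by blast
  have "S \<subseteq> poly_vs.span ?T"
    using assms(3) by (auto simp: box_polys_def intro: span_monomials)
  then have "card S \<le> card ?T"
    using indep_mod_card_le_span[OF assms(1,2), of ?T] fin by simp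
  also have "\<dots> \<le> (M + 1) ^ card X"
    using card_image_le[OF fin] card_exponent_box[OF assms(4)] by metis
  finally show ?thesis .
qed

text \<open>Up to the constant \<open>e\<close>, this says that the dimension of the polynomials with exponents at most \<open>N\<close>
  modulo \<open>Q\<close> grows at least like \<open>N ^ r\<close>. It takes the place of the statement that the residue ring
  modulo \<open>Q\<close> has transcendence degree at least \<open>r\<close>.\<close>

definition growth_at_least :: "'v set \<Rightarrow> (('v \<Rightarrow>\<^sub>0 nat) \<Rightarrow>\<^sub>0 'k::field) set \<Rightarrow> nat \<Rightarrow> bool" where
  "growth_at_least X Q r \<longleftrightarrow>
    (\<exists>e. \<forall>N\<ge>1. \<exists>S. indep_mod Q S \<and> card S = N ^ r \<and> S \<subseteq> box_polys X (e * N))"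

lemma growth_var_prime:
  fixes X :: "'v set"
  assumes "finite X"
  shows "growth_at_least X (var_prime X C :: (('v \<Rightarrow>\<^sub>0 nat) \<Rightarrow>\<^sub>0 'k::field) set) (card (X - C))"
  unfolding growth_at_least_def
proof (intro exI[of _ 1] allI impI)
  fix N :: nat assume N: "N \<ge> 1"
  let ?B = "exponent_box (X - C) (N - 1)"
  let ?b = "\<lambda>m. Poly_Mapping.single m (1::'k)"
  let ?Q = "var_prime X C :: (('v \<Rightarrow>\<^sub>0 nat) \<Rightarrow>\<^sub>0 'k) set"
  have B: "finite ?B" "card ?B = N ^ card (X - C)"
    using card_exponent_box[of "X - C" "N - 1"] assms N by auto
  have indep: "c i = 0" if "(\<Sum>i\<in>?B. scalar (c i) (?b i)) \<in> ?Q" "i \<in> ?B" for c i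
  proof (rule ccontr)
    assume "c i \<noteq> 0"
    have "Poly_Mapping.lookup (\<Sum>i\<in>?B. scalar (c i) (?b i)) i = c i"
      using B(1) that(2) by (simp add: lookup_sum lookup_single when_def sum.delta')
    then have "i \<in> Poly_Mapping.keys (\<Sum>i\<in>?B. scalar (c i) (?b i))"
      using \<open>c i \<noteq> 0\<close> by (simp add: in_keys_iff)
    then show False
      using that by (auto simp: var_prime_def exponent_box_def)
  qed
  have zero: "0 \<in> ?Q" by (simp add: var_prime_def)
  have "inj_on ?b ?B" "indep_mod ?Q (?b ` ?B)"
    using indep_mod_family[OF B(1) zero, of ?b] indep by blast+
  moreover have "?b ` ?B \<subseteq> box_polys X (1 * N)"
    using N exponent_box_mono[of "N - 1" N X] by (fastforce simp: box_polys_def exponent_box_def)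
  ultimately show "\<exists>S. indep_mod ?Q S \<and> card S = N ^ card (X - C) \<and> S \<subseteq> box_polys X (1 * N)"
    using B card_image by metis
qed

text \<open>A relation \<open>\<Sum>j. f ^ j * g j \<in> Q\<close> gives \<open>g 0 \<in> Q'\<close> because \<open>f \<in> Q'\<close>, hence \<open>g 0 = 0\<close>.
  As \<open>f \<notin> Q\<close> and \<open>Q\<close> is prime, the relation can be divided by \<open>f\<close>, and the argument repeated.\<close>

lemma power_combination_zero:
  fixes Q Q' :: "(('v \<Rightarrow>\<^sub>0 nat) \<Rightarrow>\<^sub>0 'k::field) set"
  assumes Q: "primeideal Q (mpoly_ring X)" and Q': "ideal Q' (mpoly_ring X)" "Q \<subseteq> Q'"
    and f: "f \<in> Q'" "f \<notin> Q"
    and g: "\<And>j. g j \<in> polys X" "\<And>j. g j \<in> Q' \<Longrightarrow> g j = 0"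
    and sum: "(\<Sum>j<N. f ^ j * g j) \<in> Q" and j: "j < N"
  shows "g j = 0"
  using g sum j
proof (induction N arbitrary: g j)
  case 0
  then show ?case by simp
next
  case (Suc N)
  have f_polys: "f \<in> polys X" using f Q' ideal_in_polys by blast
  let ?s = "\<Sum>j<N. f ^ j * g (Suc j)"
  have s: "?s \<in> polys X" using f_polys Suc.prems(1) by (intro polys_sum) auto
  have eq: "(\<Sum>j<Suc N. f ^ j * g j) = g 0 + f * ?s"
    by (simp add: sum.lessThan_Suc_shift sum_distrib_left mult.assoc del: sum.lessThan_Suc)
  have "g 0 + f * ?s \<in> Q'" using Suc.prems(3) eq Q'(2) by auto
  moreover have "f * ?s \<in> Q'" using ideal_mult_right[OF Q'(1) s f(1)] .
  ultimately have "g 0 \<in> Q'" using ideal_minus[OF Q'(1), of "g 0 + f * ?s" "f * ?s"] by simp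
  then have g0: "g 0 = 0" using Suc.prems(2) by blast
  then have "f * ?s \<in> Q" using Suc.prems(3) eq by simp
  then have "?s \<in> Q" using prime_mult[OF Q] f(2) f_polys s by blast
  then have "g (Suc i) = 0" if "i < N" for i
    using Suc.IH[of "\<lambda>j. g (Suc j)" i] Suc.prems(1,2) that by blast
  then show ?case using g0 Suc.prems(4) by (cases j) auto
qed

text \<open>An element \<open>f\<close> of \<open>Q'\<close> outside the smaller prime \<open>Q\<close> is transcendental over what is independent
  modulo \<open>Q'\<close>: from an independent set \<open>S\<close> modulo \<open>Q'\<close> one gets the \<open>N\<close> times larger set
  \<open>{f ^ j * b | j < N, b \<in> S}\<close>, which is independent modulo \<open>Q\<close>.\<close>

lemma growth_step:
  fixes Q Q' :: "(('v \<Rightarrow>\<^sub>0 nat) \<Rightarrow>\<^sub>0 'k::field) set"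
  assumes Q: "primeideal Q (mpoly_ring X)" and Q': "ideal Q' (mpoly_ring X)" "Q \<subset> Q'"
    and growth: "growth_at_least X Q' r"
  shows "growth_at_least X Q (Suc r)"
proof -
  from Q' obtain f where f: "f \<in> Q'" "f \<notin> Q" by blast
  have f_polys: "f \<in> polys X" using f Q' ideal_in_polys by blast
  then obtain d where d: "f \<in> box_polys X d" using polys_in_box by blast
  from growth obtain e where e: "\<And>N. N \<ge> 1 \<Longrightarrow>
      \<exists>S. indep_mod Q' S \<and> card S = N ^ r \<and> S \<subseteq> box_polys X (e * N)"
    unfolding growth_at_least_def by blast
  have "\<exists>S. indep_mod Q S \<and> card S = N ^ Suc r \<and> S \<subseteq> box_polys X ((d + e) * N)" if N: "N \<ge> 1" for N
  proof -
    from e[OF N] obtain S where S: "indep_mod Q' S" "card S = N ^ r" "S \<subseteq> box_polys X (e * N)" by blast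
    let ?A = "{..<N} \<times> S"
    let ?b = "\<lambda>(j, b). f ^ j * b"
    have fin: "finite S" using S(1) by (simp add: indep_mod_def)
    have indep: "c i = 0" if sum: "(\<Sum>i\<in>?A. scalar (c i) (?b i)) \<in> Q" and i: "i \<in> ?A" for c i
    proof -
      define g where "g j = (\<Sum>b\<in>S. scalar (c (j, b)) b)" for j
      have "(\<Sum>i\<in>?A. scalar (c i) (?b i)) = (\<Sum>j<N. f ^ j * g j)"
        by (simp add: sum.cartesian_product g_def sum_distrib_left scalar_mult case_prod_unfold)
      then have "(\<Sum>j<N. f ^ j * g j) \<in> Q" using sum by simp
      moreover have coeff: "c (j, b) = 0" if "g j \<in> Q'" "b \<in> S" for j b
        using S(1) that unfolding indep_mod_def g_def by (auto dest: spec[of _ "\<lambda>b. c (j, b)"])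
      moreover have "g j = 0" if "g j \<in> Q'" for j
        using coeff[OF that] by (simp add: g_def)
      moreover have "g j \<in> polys X" for j
        unfolding g_def using S(3) box_polys_subset_polys by (intro polys_sum scalar_in_polys) blast
      ultimately have "g j = 0" if "j < N" for j
        using power_combination_zero[OF Q Q'(1) _ f, of g N j] Q'(2) that by blast
      then show ?thesis
        using i coeff ideal_zero[OF Q'(1)] by (cases i) auto
    qed
    have "inj_on ?b ?A" "indep_mod Q (?b ` ?A)"
      using indep_mod_family[of ?A Q ?b] fin indep ideal_zero[OF prime_is_ideal[OF Q]] by blast+
    moreover have "card ?A = N ^ Suc r" using S(2) by (simp add: card_cartesian_product)
    moreover have "?b ` ?A \<subseteq> box_polys X ((d + e) * N)"
    proof clarify
      fix j b assume j: "j < N" and b: "b \<in> S"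
      have "f ^ j * b \<in> box_polys X (j * d + e * N)"
        using b S(3) d by (intro box_polys_mult box_polys_power) auto
      moreover have "j * d + e * N \<le> (d + e) * N" using j by (simp add: algebra_simps)
      ultimately show "f ^ j * b \<in> box_polys X ((d + e) * N)" using box_polys_mono by blast
    qed
    ultimately show ?thesis using card_image by metis
  qed
  then show ?thesis unfolding growth_at_least_def by blast
qed

lemma growth_le_card:
  fixes Q :: "(('v \<Rightarrow>\<^sub>0 nat) \<Rightarrow>\<^sub>0 'k::field) set"
  assumes "growth_at_least X Q r" "finite X" "0 \<in> Q"
  shows "r \<le> card X"
proof (rule ccontr)
  assume "\<not> ?thesis"
  then have r: "r \<ge> Suc (card X)" by simp
  from assms(1) obtain e where e: "\<And>N. N \<ge> 1 \<Longrightarrow>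
      \<exists>S. indep_mod Q S \<and> card S = N ^ r \<and> S \<subseteq> box_polys X (e * N)"
    unfolding growth_at_least_def by blast
  \<comment> \<open>The inequality \<open>N ^ r \<le> ((e + 1) * N) ^ card X\<close> fails with \<open>r > card X\<close> once \<open>N\<close> exceeds the constant factor.\<close>
  define N where "N = Suc ((e + 1) ^ card X)"
  have N: "N \<ge> 1" by (simp add: N_def)
  from e[OF N] obtain S where "indep_mod Q S" "card S = N ^ r" "S \<subseteq> box_polys X (e * N)" by blast
  then have "N ^ r \<le> (e * N + 1) ^ card X" using indep_mod_card_le assms by metis
  also have "\<dots> \<le> ((e + 1) * N) ^ card X" using N by (intro power_mono) auto
  finally have "N ^ r \<le> (e + 1) ^ card X * N ^ card X" by (simp only: power_mult_distrib)
  moreover have "N * N ^ card X \<le> N ^ r"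
    using power_increasing[OF r N] by simp
  ultimately have "N * N ^ card X \<le> (e + 1) ^ card X * N ^ card X" by linarith
  moreover have "0 < N ^ card X" using N by simp
  ultimately have "N \<le> (e + 1) ^ card X" by (rule mult_right_le_imp_le)
  then show False by (simp add: N_def)
qed

text \<open>Each step down a chain of primes raises the growth exponent by one. It is at least
  \<open>card (V - C)\<close> at the top of the chain and at most \<open>card V\<close> at the bottom.\<close>

lemma prime_height_var_prime_le:
  fixes V C :: "'v set"
  assumes "finite V" "C \<subseteq> V"
  shows "prime_height (mpoly_ring V) (var_prime V C :: (('v \<Rightarrow>\<^sub>0 nat) \<Rightarrow>\<^sub>0 'k::field) set) \<le> enat (card C)"
  unfolding prime_height_def
proof (rule SUP_least, clarify)
  fix k and D :: "nat \<Rightarrow> (('v \<Rightarrow>\<^sub>0 nat) \<Rightarrow>\<^sub>0 'k) set"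
  assume D: "\<forall>i\<le>k. primeideal (D i) (mpoly_ring V)" "\<forall>i<k. D i \<subset> D (Suc i)"
    "D k = var_prime V C"
  have "growth_at_least V (D (k - j)) (card (V - C) + j)" if "j \<le> k" for j
    using that
  proof (induction j)
    case 0
    then show ?case using growth_var_prime[OF assms(1), of C] D(3) by simp
  next
    case (Suc j)
    then have "D (k - Suc j) \<subset> D (Suc (k - Suc j))" using D(2) by simp
    then have "D (k - Suc j) \<subset> D (k - j)" using Suc.prems by (simp add: Suc_diff_Suc)
    then show ?case
      using growth_step[of "D (k - Suc j)" V "D (k - j)"] D(1) Suc prime_is_ideal[of "D (k - j)" V] by simp
  qed
  from this[of k] have "growth_at_least V (D 0) (card (V - C) + k)" by simp
  then have "card (V - C) + k \<le> card V"
    using growth_le_card assms(1) D(1) ideal_zero[OF prime_is_ideal[of "D 0" V]] by blast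
  then show "enat k \<le> enat (card C)"
    using assms card_Diff_subset[of C V] card_mono[of V C] finite_subset[of C V] by simp
qed

section \<open>Ideals with few generators\<close>

subsection \<open>Setting variables to one\<close>

lift_definition restrict_exponent :: "'v set \<Rightarrow> ('v \<Rightarrow>\<^sub>0 nat) \<Rightarrow> ('v \<Rightarrow>\<^sub>0 nat)"
  is "\<lambda>V m v. if v \<in> V then m v else 0"
  by (erule finite_subset[rotated]) auto

lemma lookup_restrict_exponent:
  "Poly_Mapping.lookup (restrict_exponent V m) v = (if v \<in> V then Poly_Mapping.lookup m v else 0)"
  by transfer simp

lemma restrict_exponent_add: "restrict_exponent V (a + b) = restrict_exponent V a + restrict_exponent V b"
  by (rule poly_mapping_eqI) (simp add: lookup_restrict_exponent lookup_add)

lemma keys_restrict_exponent: "Poly_Mapping.keys (restrict_exponent V m) = Poly_Mapping.keys m \<inter> V"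
  by (auto simp: in_keys_iff lookup_restrict_exponent split: if_splits)

text \<open>The substitution that sets every variable outside \<open>V\<close> to \<open>1\<close>; on monomials it forgets the exponents
  outside \<open>V\<close>.\<close>

definition set_one_outside :: "'v set \<Rightarrow> (('v \<Rightarrow>\<^sub>0 nat) \<Rightarrow>\<^sub>0 'k::comm_ring_1) \<Rightarrow> (('v \<Rightarrow>\<^sub>0 nat) \<Rightarrow>\<^sub>0 'k)" where
  "set_one_outside V p =
    (\<Sum>m\<in>Poly_Mapping.keys p. Poly_Mapping.single (restrict_exponent V m) (Poly_Mapping.lookup p m))"

lemma set_one_superset:
  assumes "finite S" "Poly_Mapping.keys p \<subseteq> S"
  shows "set_one_outside V p = (\<Sum>m\<in>S. Poly_Mapping.single (restrict_exponent V m) (Poly_Mapping.lookup p m))"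
  unfolding set_one_outside_def using assms by (intro sum.mono_neutral_left) (auto simp: in_keys_iff)

lemma set_one_add: "set_one_outside V (p + q) = set_one_outside V p + set_one_outside V q"
proof -
  let ?S = "Poly_Mapping.keys p \<union> Poly_Mapping.keys q"
  show ?thesis
    using set_one_superset[of ?S p V] set_one_superset[of ?S q V] set_one_superset[of ?S "p + q" V]
      Poly_Mapping.keys_add[of p q]
    by (simp add: lookup_add single_add sum.distrib)
qed

lemma set_one_zero [simp]: "set_one_outside V 0 = 0"
  by (simp add: set_one_outside_def)

lemma set_one_single [simp]:
  "set_one_outside V (Poly_Mapping.single m c) = Poly_Mapping.single (restrict_exponent V m) c"
  by (cases "c = 0") (simp_all add: set_one_outside_def)

lemma set_one_sum: "set_one_outside V (sum f A) = (\<Sum>i\<in>A. set_one_outside V (f i))"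
  by (induction A rule: infinite_finite_induct) (simp_all add: set_one_add)

lemma set_one_mult: "set_one_outside V (p * q) = set_one_outside V p * set_one_outside V q"
proof -
  have "set_one_outside V (p * q) = (\<Sum>a\<in>Poly_Mapping.keys p. \<Sum>b\<in>Poly_Mapping.keys q.
      Poly_Mapping.single (restrict_exponent V a + restrict_exponent V b)
        (Poly_Mapping.lookup p a * Poly_Mapping.lookup q b))"
    by (subst mult_sum_monomials) (simp add: set_one_sum restrict_exponent_add)
  also have "\<dots> = set_one_outside V p * set_one_outside V q"
    by (simp add: set_one_outside_def sum_product mult_single)
  finally show ?thesis .
qed

lemma set_one_one [simp]: "set_one_outside V 1 = 1"
proof -
  have "restrict_exponent V 0 = 0"
    by (rule poly_mapping_eqI) (simp add: lookup_restrict_exponent)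
  then show ?thesis using set_one_single[of V 0 1] by simp
qed

lemma set_one_power: "set_one_outside V (p ^ k) = set_one_outside V p ^ k"
  by (induction k) (simp_all add: set_one_mult)

lemma set_one_indet: "set_one_outside V (indet v) = (if v \<in> V then indet v else 1)"
proof -
  have "restrict_exponent V (Poly_Mapping.single v 1) = (if v \<in> V then Poly_Mapping.single v 1 else 0)"
    by (rule poly_mapping_eqI) (auto simp: lookup_restrict_exponent lookup_single when_def)
  then show ?thesis by (simp add: indet_def)
qed

lemma keys_set_one:
  "Poly_Mapping.keys (set_one_outside V p) \<subseteq> restrict_exponent V ` Poly_Mapping.keys p"
  unfolding set_one_outside_def
  using keys_sum[of "\<lambda>m. Poly_Mapping.single (restrict_exponent V m) (Poly_Mapping.lookup p m)" "Poly_Mapping.keys p"]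
  by (auto split: if_splits)

lemma set_one_in_polys [intro]: "set_one_outside V p \<in> polys V"
  using keys_set_one[of V p] by (auto simp: polys_def keys_restrict_exponent)

subsection \<open>Order of vanishing at the origin\<close>

definition order_at_least :: "'v set \<Rightarrow> nat \<Rightarrow> (('v \<Rightarrow>\<^sub>0 nat) \<Rightarrow>\<^sub>0 'k::comm_ring_1) set" where
  "order_at_least V j = {p. \<forall>m\<in>Poly_Mapping.keys p. j \<le> (\<Sum>v\<in>V. Poly_Mapping.lookup m v)}"

lemma order_zero [simp]: "0 \<in> order_at_least V j"
  by (simp add: order_at_least_def)

lemma order_add: "p \<in> order_at_least V j \<Longrightarrow> q \<in> order_at_least V j \<Longrightarrow> p + q \<in> order_at_least V j"
  using Poly_Mapping.keys_add[of p q] by (auto simp: order_at_least_def)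

lemma order_sum: "(\<And>i. i \<in> A \<Longrightarrow> f i \<in> order_at_least V j) \<Longrightarrow> sum f A \<in> order_at_least V j"
  by (induction A rule: infinite_finite_induct) (auto intro: order_add)

lemma order_mult:
  assumes "p \<in> order_at_least V i" "q \<in> order_at_least V j"
  shows "p * q \<in> order_at_least V (i + j)"
  unfolding order_at_least_def
proof (clarify)
  fix m assume "m \<in> Poly_Mapping.keys (p * q)"
  then obtain a b where "m = a + b" "a \<in> Poly_Mapping.keys p" "b \<in> Poly_Mapping.keys q"
    using keys_mult[of p q] by blast
  then show "i + j \<le> (\<Sum>v\<in>V. Poly_Mapping.lookup m v)"
    using assms by (auto simp: order_at_least_def lookup_add sum.distrib intro!: add_mono)
qed

lemma order_scalar: "p \<in> order_at_least V j \<Longrightarrow> scalar c p \<in> order_at_least V j"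
  using order_mult[of "Poly_Mapping.single 0 c" V 0 p j] by (simp add: scalar_def) (simp add: order_at_least_def)

lemma set_one_var_prime:
  assumes "finite V" "p \<in> var_prime Z V"
  shows "set_one_outside V p \<in> order_at_least V 1"
proof -
  have "1 \<le> (\<Sum>v\<in>V. Poly_Mapping.lookup (restrict_exponent V m) v)" if m: "m \<in> Poly_Mapping.keys p" for m
  proof -
    from assms m obtain v where v: "v \<in> V" "v \<in> Poly_Mapping.keys m" by (auto simp: var_prime_def)
    then have "1 \<le> Poly_Mapping.lookup (restrict_exponent V m) v"
      by (simp add: lookup_restrict_exponent in_keys_iff)
    also have "\<dots> \<le> (\<Sum>v\<in>V. Poly_Mapping.lookup (restrict_exponent V m) v)"
      using v assms(1) by (intro member_le_sum) auto
    finally show ?thesis .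
  qed
  then show ?thesis using keys_set_one[of V p] by (auto simp: order_at_least_def)
qed

subsection \<open>Counting generators\<close>

text \<open>For fixed \<open>V\<close> and \<open>M\<close> these are only \<open>O(j ^ s)\<close> polynomials; if the \<open>b i\<close> have order
  at least one and generate an ideal containing a power of every variable in \<open>V\<close>, then for large \<open>M\<close> they span
  the ring in the variables \<open>V\<close> modulo polynomials of order at least \<open>j\<close>.\<close>

definition box_products :: "'v set \<Rightarrow> nat \<Rightarrow> nat \<Rightarrow> (nat \<Rightarrow> (('v \<Rightarrow>\<^sub>0 nat) \<Rightarrow>\<^sub>0 'k::field)) \<Rightarrow> nat \<Rightarrow> (('v \<Rightarrow>\<^sub>0 nat) \<Rightarrow>\<^sub>0 'k) set" where
  "box_products V M s b j = (\<lambda>(m, \<alpha>). Poly_Mapping.single m 1 * (\<Prod>i<s. b i ^ \<alpha> i)) `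
    (exponent_box V M \<times> ({..<s} \<rightarrow>\<^sub>E {..<j}))"

lemma card_box_products:
  assumes "finite V"
  shows "finite (box_products V M s b j)" "card (box_products V M s b j) \<le> (M + 1) ^ card V * j ^ s"
proof -
  have fin: "finite (exponent_box V M \<times> ({..<s} \<rightarrow>\<^sub>E {..<j}))"
    using card_exponent_box[OF assms] by (auto intro: finite_PiE)
  then show "finite (box_products V M s b j)" by (auto simp: box_products_def)
  show "card (box_products V M s b j) \<le> (M + 1) ^ card V * j ^ s"
    using card_image_le[OF fin] card_exponent_box[OF assms, of M]
    by (simp add: box_products_def card_cartesian_product card_PiE)
qed

lemma box_products_mult:
  assumes "i < s" "t \<in> poly_vs.span (box_products V M s b j)"
  shows "b i * t \<in> poly_vs.span (box_products V M s b (Suc j))"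
proof -
  let ?D = "{t. b i * t \<in> poly_vs.span (box_products V M s b (Suc j))}"
  have "poly_vs.subspace ?D"
    by (auto simp: poly_vs.subspace_def scalar_mult distrib_left
        intro: poly_vs.span_zero poly_vs.span_add poly_vs.span_scale)
  moreover have "box_products V M s b j \<subseteq> ?D"
  proof
    fix x assume "x \<in> box_products V M s b j"
    then obtain m \<alpha> where x: "x = Poly_Mapping.single m 1 * (\<Prod>i<s. b i ^ \<alpha> i)"
      and m: "m \<in> exponent_box V M" and \<alpha>: "\<alpha> \<in> {..<s} \<rightarrow>\<^sub>E {..<j}"
      by (auto simp: box_products_def)
    let ?\<beta> = "\<alpha>(i := Suc (\<alpha> i))"
    have "(\<Prod>k<s. b k ^ ?\<beta> k) = b i ^ Suc (\<alpha> i) * (\<Prod>k\<in>{..<s} - {i}. b k ^ \<alpha> k)"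
      using assms(1) by (subst prod.remove[of _ i]) (auto intro!: prod.cong)
    also have "\<dots> = b i * (\<Prod>k<s. b k ^ \<alpha> k)"
      using assms(1) by (subst prod.remove[of _ i]) (auto simp: mult.assoc)
    finally have "b i * x = Poly_Mapping.single m 1 * (\<Prod>k<s. b k ^ ?\<beta> k)"
      by (simp add: x ac_simps)
    moreover have "\<alpha> k < Suc j" if "k < s" for k
      using \<alpha> that by (auto simp: PiE_iff intro: less_SucI)
    then have "?\<beta> \<in> {..<s} \<rightarrow>\<^sub>E {..<Suc j}"
      using assms(1) \<alpha> by (auto simp: PiE_iff extensional_def)
    ultimately have "b i * x \<in> box_products V M s b (Suc j)"
      using m unfolding box_products_def by (intro image_eqI[of _ _ "(m, ?\<beta>)"]) auto
    then show "x \<in> ?D" by (auto intro: poly_vs.span_base)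
  qed
  ultimately show ?thesis using poly_vs.span_minimal assms(2) by blast
qed

text \<open>A monomial with a large exponent is a multiple of one of the powers of variables lying in the
  ideal generated by the \<open>b i\<close>; the finitely many other monomials make up the remainder \<open>c\<close>.\<close>

lemma decompose_mod_generators:
  fixes V :: "'v set" and b :: "nat \<Rightarrow> (('v \<Rightarrow>\<^sub>0 nat) \<Rightarrow>\<^sub>0 'k::field)"
  assumes V: "finite V"
    and gen: "\<And>v. v \<in> V \<Longrightarrow> \<exists>k g. (\<forall>i. g i \<in> polys V) \<and> indet v ^ k = (\<Sum>i<s. b i * g i)"
  obtains M where "\<And>p. p \<in> polys V \<Longrightarrow>
    \<exists>c g. c \<in> box_polys V M \<and> (\<forall>i. g i \<in> polys V) \<and> p = c + (\<Sum>i<s. b i * g i)"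
proof -
  from gen have "\<forall>v\<in>V. \<exists>k g. (\<forall>i. g i \<in> polys V) \<and> indet v ^ k = (\<Sum>i<s. b i * g i)" by blast
  then obtain k g where g: "\<And>v i. v \<in> V \<Longrightarrow> g v i \<in> polys V"
    "\<And>v. v \<in> V \<Longrightarrow> indet v ^ k v = (\<Sum>i<s. b i * g v i)"
    by metis
  define M where "M = sum k V"
  let ?D = "\<lambda>p. \<exists>c g. c \<in> box_polys V M \<and> (\<forall>i. g i \<in> polys V) \<and> p = c + (\<Sum>i<s. b i * g i)"
  have zero: "?D 0"
    by (intro exI[of _ 0] exI[of _ "\<lambda>_. 0"]) (auto simp: box_polys_def)
  have add: "?D (p + q)" if p: "?D p" and q: "?D q" for p q
  proof -
    from p obtain c g where 1: "c \<in> box_polys V M" "\<forall>i. g i \<in> polys V" "p = c + (\<Sum>i<s. b i * g i)"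
      by blast
    from q obtain c' g' where 2: "c' \<in> box_polys V M" "\<forall>i. g' i \<in> polys V" "q = c' + (\<Sum>i<s. b i * g' i)"
      by blast
    have "c + c' \<in> box_polys V M"
      using 1(1) 2(1) Poly_Mapping.keys_add[of c c'] by (auto simp: box_polys_def)
    moreover have "p + q = (c + c') + (\<Sum>i<s. b i * (g i + g' i))"
      using 1(3) 2(3) by (simp add: distrib_left sum.distrib)
    moreover have "\<forall>i. g i + g' i \<in> polys V" using 1(2) 2(2) by auto
    ultimately show ?thesis by (intro exI[of _ "c + c'"] exI[of _ "\<lambda>i. g i + g' i"]) simp
  qed
  have monomial: "?D (Poly_Mapping.single m c)" if m: "Poly_Mapping.keys m \<subseteq> V" for m c
  proof (cases "m \<in> exponent_box V M")
    case True
    then have "Poly_Mapping.single m c \<in> box_polys V M" by (auto simp: box_polys_def)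
    then show ?thesis
      by (intro exI[of _ "Poly_Mapping.single m c"] exI[of _ "\<lambda>_. 0"]) auto
  next
    case False
    then obtain v where v: "M < Poly_Mapping.lookup m v" using m by (auto simp: exponent_box_def not_le)
    then have vV: "v \<in> V" using m by (auto simp: in_keys_iff)
    then have "k v \<le> Poly_Mapping.lookup m v"
      using v V member_le_sum[of v V k] by (simp add: M_def)
    from monomial_divide_indet[OF this, of c]
    obtain m' where m': "Poly_Mapping.keys m' \<subseteq> Poly_Mapping.keys m"
      "Poly_Mapping.single m c = indet v ^ k v * Poly_Mapping.single m' c"
      by (elim exE conjE)
    have "Poly_Mapping.single m c = 0 + (\<Sum>i<s. b i * (g v i * Poly_Mapping.single m' c))"
      using m'(2) g(2)[OF vV] by (simp add: sum_distrib_right mult.assoc)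
    moreover have "g v i * Poly_Mapping.single m' c \<in> polys V" for i
      using g(1)[OF vV] m m'(1) by (intro polys_closed polys_single) auto
    ultimately show ?thesis
      by (intro exI[of _ 0] exI[of _ "\<lambda>i. g v i * Poly_Mapping.single m' c"]) (auto simp: box_polys_def)
  qed
  have "?D p" if p: "p \<in> polys V" for p
  proof -
    have sum: "?D (sum f A)" if "\<And>i. i \<in> A \<Longrightarrow> ?D (f i)" for f and A :: "('v \<Rightarrow>\<^sub>0 nat) set"
      using that
    proof (induction A rule: infinite_finite_induct)
      case (insert x F)
      then show ?case using add[of "f x" "sum f F"] by simp
    qed (use zero in simp_all)
    have "?D (\<Sum>m\<in>Poly_Mapping.keys p. Poly_Mapping.single m (Poly_Mapping.lookup p m))"
      using p by (intro sum monomial) (auto simp: polys_def)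
    then show ?thesis by (simp flip: poly_sum_monomials)
  qed
  then show ?thesis using that by blast
qed

text \<open>Iterating the decomposition \<open>p = c + \<Sum>i. b i * g i\<close> on the coefficients \<open>g i\<close> pushes the
  error to higher and higher order, since each \<open>b i\<close> has order at least one.\<close>

lemma box_products_span_mod_order:
  fixes b :: "nat \<Rightarrow> (('v \<Rightarrow>\<^sub>0 nat) \<Rightarrow>\<^sub>0 'k::field)"
  assumes b: "\<And>i. i < s \<Longrightarrow> b i \<in> order_at_least V 1"
    and decompose: "\<And>p. p \<in> polys V \<Longrightarrow>
      \<exists>c g. c \<in> box_polys V M \<and> (\<forall>i. g i \<in> polys V) \<and> p = c + (\<Sum>i<s. b i * g i)"
    and "p \<in> polys V"
  shows "\<exists>t \<in> poly_vs.span (box_products V M s b j). p - t \<in> order_at_least V j"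
  using assms(3)
proof (induction j arbitrary: p)
  case 0
  then show ?case
    by (intro bexI[of _ 0]) (auto simp: order_at_least_def intro: poly_vs.span_zero)
next
  case (Suc j)
  obtain c g where c: "c \<in> box_polys V M" and g: "\<And>i. g i \<in> polys V"
    and p: "p = c + (\<Sum>i<s. b i * g i)" using decompose[OF Suc.prems] by blast
  from Suc.IH g have "\<forall>i. \<exists>t \<in> poly_vs.span (box_products V M s b j). g i - t \<in> order_at_least V j"
    by blast
  then obtain t where t: "\<And>i. t i \<in> poly_vs.span (box_products V M s b j)"
    "\<And>i. g i - t i \<in> order_at_least V j" by metis
  let ?t = "c + (\<Sum>i<s. b i * t i)"
  have "(\<lambda>m. Poly_Mapping.single m 1) ` exponent_box V M \<subseteq> box_products V M s b (Suc j)"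
  proof clarify
    fix m assume "m \<in> exponent_box V M"
    moreover have "(\<lambda>i\<in>{..<s}. 0) \<in> {..<s} \<rightarrow>\<^sub>E {..<Suc j}" by auto
    moreover have "Poly_Mapping.single m 1 = Poly_Mapping.single m 1 * (\<Prod>i<s. b i ^ (\<lambda>i\<in>{..<s}. 0) i)"
      by simp
    ultimately show "Poly_Mapping.single m 1 \<in> box_products V M s b (Suc j)"
      unfolding box_products_def by (intro image_eqI[of _ _ "(m, \<lambda>i\<in>{..<s}. 0)"]) auto
  qed
  then have "c \<in> poly_vs.span (box_products V M s b (Suc j))"
    using span_monomials[of c] c poly_vs.span_mono unfolding box_polys_def by blast
  then have "?t \<in> poly_vs.span (box_products V M s b (Suc j))"
    using t(1) by (intro poly_vs.span_add poly_vs.span_sum box_products_mult) auto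
  moreover have "p - ?t = (\<Sum>i<s. b i * (g i - t i))"
    by (simp add: p right_diff_distrib sum_subtractf)
  moreover have "\<dots> \<in> order_at_least V (1 + j)"
    using b t(2) by (intro order_sum order_mult) auto
  ultimately show ?case by (intro bexI[of _ ?t]) simp_all
qed

text \<open>This is the case of Krull's height theorem for the ideal of all variables: if it is the radical
  of an ideal with \<open>s\<close> generators, then \<open>s\<close> is at least the number of variables. The monomials
  with exponents at most \<open>K\<close> have order at most \<open>n * K\<close>, so they stay independent modulo polynomials of order at
  least \<open>j = n * K + 1\<close>; there are \<open>(K + 1) ^ n\<close> of them in a space spanned by \<open>O(K ^ s)\<close> products.\<close>

lemma card_le_number_of_generators:
  fixes V :: "'v set" and b :: "nat \<Rightarrow> (('v \<Rightarrow>\<^sub>0 nat) \<Rightarrow>\<^sub>0 'k::field)"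
  assumes V: "finite V"
    and b: "\<And>i. i < s \<Longrightarrow> b i \<in> order_at_least V 1"
    and gen: "\<And>v. v \<in> V \<Longrightarrow> \<exists>k g. (\<forall>i. g i \<in> polys V) \<and> indet v ^ k = (\<Sum>i<s. b i * g i)"
  shows "card V \<le> s"
proof (rule ccontr)
  define n where "n = card V"
  assume "\<not> ?thesis"
  then have n: "Suc s \<le> n" by (simp add: n_def)
  obtain M where M: "\<And>p. p \<in> polys V \<Longrightarrow>
      \<exists>c g. c \<in> box_polys V M \<and> (\<forall>i. g i \<in> polys V) \<and> p = c + (\<Sum>i<s. b i * g i)"
    using decompose_mod_generators[OF V gen] by blast
  \<comment> \<open>Chosen so that \<open>(M + 1) ^ n * (n * K + 1) ^ s \<le> K * (K + 1) ^ s\<close>, which is less than \<open>(K + 1) ^ n\<close> if \<open>s < n\<close>.\<close>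
  define K where "K = (M + 1) ^ n * (n + 1) ^ s"
  define j where "j = n * K + 1"
  let ?T = "box_products V M s b j"
  let ?B = "exponent_box V K"
  let ?x = "\<lambda>m. Poly_Mapping.single m (1::'k)"
  have B: "finite ?B" "card ?B = (K + 1) ^ n" using card_exponent_box[OF V] by (auto simp: n_def)
  have "\<exists>t \<in> poly_vs.span ?T. ?x m - t \<in> order_at_least V j" if "m \<in> ?B" for m
    using that by (intro box_products_span_mod_order[OF b M]) (auto simp: exponent_box_def)
  then obtain t where t: "\<And>m. m \<in> ?B \<Longrightarrow> t m \<in> poly_vs.span ?T"
    "\<And>m. m \<in> ?B \<Longrightarrow> ?x m - t m \<in> order_at_least V j" by metis
  have indep: "c i = 0" if sum: "(\<Sum>m\<in>?B. scalar (c m) (t m)) \<in> {0}" and i: "i \<in> ?B" for c i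
  proof (rule ccontr)
    assume "c i \<noteq> 0"
    have "(\<Sum>m\<in>?B. scalar (c m) (?x m)) = (\<Sum>m\<in>?B. scalar (c m) (?x m - t m))"
      using sum by (simp add: poly_vs.scale_right_diff_distrib sum_subtractf del: scalar_single)
    also have "\<dots> \<in> order_at_least V j"
      using t(2) by (intro order_sum order_scalar) auto
    finally have "(\<Sum>m\<in>?B. scalar (c m) (?x m)) \<in> order_at_least V j" .
    moreover have "Poly_Mapping.lookup (\<Sum>m\<in>?B. scalar (c m) (?x m)) i = c i"
      using B(1) i by (simp add: lookup_sum lookup_single when_def sum.delta')
    ultimately have "j \<le> (\<Sum>v\<in>V. Poly_Mapping.lookup i v)"
      using \<open>c i \<noteq> 0\<close> by (auto simp: order_at_least_def in_keys_iff)
    also have "\<dots> \<le> (\<Sum>v\<in>V. K)" using i by (intro sum_mono) (auto simp: exponent_box_def)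
    finally show False by (simp add: j_def n_def)
  qed
  have "inj_on t ?B" "indep_mod {0} (t ` ?B)"
    using indep_mod_family[OF B(1), of "{0}" t] indep by blast+
  then have "card ?B \<le> card ?T"
    using indep_mod_card_le_span[of "{0}" "t ` ?B" ?T] card_box_products(1)[OF V] t(1) card_image
    by (metis image_subsetI singletonI)
  then have "(K + 1) ^ n \<le> (M + 1) ^ n * j ^ s"
    using B(2) card_box_products(2)[OF V, of M s b j] unfolding n_def by simp
  also have "\<dots> \<le> (M + 1) ^ n * ((n + 1) * (K + 1)) ^ s"
    by (intro mult_left_mono power_mono) (auto simp: j_def)
  also have "\<dots> = K * (K + 1) ^ s"
    by (simp only: K_def power_mult_distrib mult.assoc)
  also have "\<dots> < (K + 1) ^ Suc s" by simp
  also have "\<dots> \<le> (K + 1) ^ n" using n by (intro power_increasing) auto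
  finally show False by simp
qed

section \<open>Sums over layers of a family closed under unions\<close>

text \<open>A variant of the lemma of Schmitt and Vogel. Multiplying the sum over the layer of \<open>A\<close> by \<open>g A\<close> gives
  \<open>g A ^ 2\<close> plus products \<open>g A * g B\<close>, and these are multiples of \<open>g (A \<union> B)\<close>, which belongs to a
  layer of larger sets and is in the radical by induction.\<close>

lemma radical_of_layer_sums:
  fixes g :: "'v set \<Rightarrow> (('v \<Rightarrow>\<^sub>0 nat) \<Rightarrow>\<^sub>0 'k::comm_ring_1)"
  assumes V: "finite V" and J: "ideal J (mpoly_ring Z)"
    and g: "\<And>A. A \<subseteq> V \<Longrightarrow> g A \<in> polys Z"
    and union: "\<And>A B. A \<subseteq> V \<Longrightarrow> B \<subseteq> V \<Longrightarrow> \<exists>r\<in>polys Z. g A * g B = r * g (A \<union> B)"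
    and layers: "\<And>l. 1 \<le> l \<Longrightarrow> l \<le> card V \<Longrightarrow> (\<Sum>A | A \<subseteq> V \<and> card A = l. g A) \<in> J"
    and "A \<subseteq> V" "A \<noteq> {}"
  shows "g A \<in> radical (mpoly_ring Z) J"
  using assms(6,7)
proof (induction "card V - card A" arbitrary: A rule: less_induct)
  case less
  let ?rad = "radical (mpoly_ring Z) J"
  note rad = ideal_radical[OF J]
  let ?L = "{B. B \<subseteq> V \<and> card B = card A}"
  have finL: "finite ?L" using V by simp
  have finA: "finite A" using less.prems V finite_subset by blast
  have "g A * g B \<in> ?rad" if B: "B \<in> ?L - {A}" for B
  proof -
    have "\<not> B \<subseteq> A" using B card_subset_eq[OF finA, of B] by auto
    then have "A \<subset> A \<union> B" by auto
    moreover have "A \<union> B \<subseteq> V" using B less.prems by auto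
    moreover have "finite (A \<union> B)" using \<open>A \<union> B \<subseteq> V\<close> V finite_subset by blast
    ultimately have "card A < card (A \<union> B)" "card (A \<union> B) \<le> card V"
      using V psubset_card_mono card_mono by metis+
    then have "g (A \<union> B) \<in> ?rad"
      using less.hyps[of "A \<union> B"] \<open>A \<union> B \<subseteq> V\<close> less.prems by auto
    moreover obtain r where "r \<in> polys Z" "g A * g B = r * g (A \<union> B)"
      using union[of A B] B less.prems by auto
    ultimately show ?thesis using ideal_mult[OF rad] by simp
  qed
  then have rest: "(\<Sum>B\<in>?L - {A}. g A * g B) \<in> ?rad" by (intro ideal_sum[OF rad])
  have "1 \<le> card A" "card A \<le> card V"
    using less.prems finA V card_mono by (auto simp: Suc_le_eq card_gt_0_iff)
  then have "(\<Sum>B\<in>?L. g B) \<in> ?rad"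
    using layers subset_radical[of J Z] ideal_in_polys[OF J] by blast
  then have "g A * (\<Sum>B\<in>?L. g B) \<in> ?rad"
    using ideal_mult[OF rad] g less.prems by blast
  moreover have "g A * (\<Sum>B\<in>?L. g B) = g A ^ 2 + (\<Sum>B\<in>?L - {A}. g A * g B)"
    using finL less.prems by (simp add: sum.remove[of ?L A] distrib_left sum_distrib_left power2_eq_square)
  ultimately have "g A ^ 2 \<in> ?rad"
    using ideal_minus[OF rad _ rest] by force
  then show ?case using radical_idem g less.prems by blast
qed

section \<open>Whiskered graphs\<close>

text \<open>The blocks of the partition are the fibres of \<open>w\<close>. New vertices outside the image of \<open>w\<close> are
  isolated; they come from empty blocks.\<close>

locale whiskered_graph =
  fixes V Y :: "'v set" and E :: "'v set set" and w :: "'v \<Rightarrow> 'v"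
  assumes finite_V: "finite V" and finite_Y: "finite Y" and disjoint: "V \<inter> Y = {}"
    and edges: "e \<in> E \<Longrightarrow> e \<subseteq> V \<and> card e = 2"
    and whisker: "x \<in> V \<Longrightarrow> w x \<in> Y"
begin

abbreviation "Z \<equiv> V \<union> Y"

definition whiskered_edges :: "'v set set" where
  "whiskered_edges = E \<union> (\<lambda>x. {x, w x}) ` V"

lemma finite_Z: "finite Z"
  using finite_V finite_Y by simp

lemma edge_subset: "e \<in> whiskered_edges \<Longrightarrow> e \<subseteq> Z"
  using edges whisker by (auto simp: whiskered_edges_def)

lemma generators_in_polys:
  "{indet u * indet v | u v. {u, v} \<in> whiskered_edges} \<subseteq> (polys Z :: (('v \<Rightarrow>\<^sub>0 nat) \<Rightarrow>\<^sub>0 'k::field) set)"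
  using edge_subset by fastforce

lemma ideal_edge_ideal:
  "ideal (edge_ideal Z whiskered_edges :: (('v \<Rightarrow>\<^sub>0 nat) \<Rightarrow>\<^sub>0 'k::field) set) (mpoly_ring Z)"
  unfolding edge_ideal_def by (rule ideal_Idl[OF generators_in_polys])

lemma edge_ideal_subset_iff:
  assumes "ideal (J :: (('v \<Rightarrow>\<^sub>0 nat) \<Rightarrow>\<^sub>0 'k::field) set) (mpoly_ring Z)"
  shows "edge_ideal Z whiskered_edges \<subseteq> J \<longleftrightarrow> (\<forall>u v. {u, v} \<in> whiskered_edges \<longrightarrow> indet u * indet v \<in> J)"
proof
  assume "edge_ideal Z whiskered_edges \<subseteq> J"
  then show "\<forall>u v. {u, v} \<in> whiskered_edges \<longrightarrow> indet u * indet v \<in> J"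
    using subset_Idl[OF generators_in_polys] unfolding edge_ideal_def by blast
next
  assume "\<forall>u v. {u, v} \<in> whiskered_edges \<longrightarrow> indet u * indet v \<in> J"
  then show "edge_ideal Z whiskered_edges \<subseteq> J"
    unfolding edge_ideal_def by (intro Idl_subset[OF assms]) auto
qed

lemma edge_product_mem:
  "{u, v} \<in> whiskered_edges \<Longrightarrow>
    indet u * indet v \<in> (edge_ideal Z whiskered_edges :: (('v \<Rightarrow>\<^sub>0 nat) \<Rightarrow>\<^sub>0 'k::field) set)"
  using edge_ideal_subset_iff[OF ideal_edge_ideal] by blast

definition vertex_cover :: "'v set \<Rightarrow> bool" where
  "vertex_cover C \<longleftrightarrow> C \<subseteq> Z \<and> (\<forall>u v. {u, v} \<in> whiskered_edges \<longrightarrow> u \<in> C \<or> v \<in> C)"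

lemma edge_ideal_subset_var_prime_iff:
  assumes "C \<subseteq> Z"
  shows "edge_ideal Z whiskered_edges \<subseteq> (var_prime Z C :: (('v \<Rightarrow>\<^sub>0 nat) \<Rightarrow>\<^sub>0 'k::field) set) \<longleftrightarrow> vertex_cover C"
    (is "_ \<subseteq> ?P \<longleftrightarrow> _")
proof -
  have P: "primeideal ?P (mpoly_ring Z)" by (rule prime_var_prime)
  have "indet u * indet v \<in> ?P \<longleftrightarrow> u \<in> C \<or> v \<in> C" if "{u, v} \<in> whiskered_edges" for u v
  proof -
    have uv: "u \<in> Z" "v \<in> Z" using edge_subset[OF that] by auto
    have "indet u * indet v \<in> ?P \<longleftrightarrow> (indet u :: ('v \<Rightarrow>\<^sub>0 nat) \<Rightarrow>\<^sub>0 'k) \<in> ?P \<or> (indet v :: ('v \<Rightarrow>\<^sub>0 nat) \<Rightarrow>\<^sub>0 'k) \<in> ?P"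
      by (rule prime_mult_iff[OF P indet_in_polys[OF uv(1)] indet_in_polys[OF uv(2)]])
    then show ?thesis by (simp only: indet_in_var_prime[OF uv(1)] indet_in_var_prime[OF uv(2)])
  qed
  then show ?thesis
    using edge_ideal_subset_iff[OF prime_is_ideal[OF P]] assms by (simp add: vertex_cover_def)
qed

lemma vertex_cover_of_prime:
  fixes P :: "(('v \<Rightarrow>\<^sub>0 nat) \<Rightarrow>\<^sub>0 'k::field) set"
  assumes P: "primeideal P (mpoly_ring Z)" and sub: "edge_ideal Z whiskered_edges \<subseteq> P"
  shows "vertex_cover {v \<in> Z. (indet v :: ('v \<Rightarrow>\<^sub>0 nat) \<Rightarrow>\<^sub>0 'k) \<in> P}"
  unfolding vertex_cover_def
proof (intro conjI allI impI)
  fix u v assume uv: "{u, v} \<in> whiskered_edges"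
  then have mem: "(indet u * indet v :: ('v \<Rightarrow>\<^sub>0 nat) \<Rightarrow>\<^sub>0 'k) \<in> P"
    using sub edge_product_mem by blast
  have uvZ: "u \<in> Z" "v \<in> Z" using edge_subset[OF uv] by auto
  show "u \<in> {v \<in> Z. (indet v :: ('v \<Rightarrow>\<^sub>0 nat) \<Rightarrow>\<^sub>0 'k) \<in> P} \<or> v \<in> {v \<in> Z. (indet v :: ('v \<Rightarrow>\<^sub>0 nat) \<Rightarrow>\<^sub>0 'k) \<in> P}"
    using prime_mult[OF P mem indet_in_polys[OF uvZ(1)] indet_in_polys[OF uvZ(2)]] uvZ by blast
qed auto

lemma vertex_cover_V: "vertex_cover V"
proof -
  have "u \<in> V \<or> v \<in> V" if uv: "{u, v} \<in> whiskered_edges" for u v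
  proof -
    from uv consider "{u, v} \<subseteq> V" | x where "x \<in> V" "{u, v} = {x, w x}"
      using edges by (auto simp: whiskered_edges_def)
    then show ?thesis by cases (auto simp: doubleton_eq_iff)
  qed
  then show ?thesis by (auto simp: vertex_cover_def)
qed

lemma prime_height_V:
  "prime_height (mpoly_ring Z) (var_prime Z V :: (('v \<Rightarrow>\<^sub>0 nat) \<Rightarrow>\<^sub>0 'k::field) set) = enat (card V)"
proof (rule antisym)
  let ?P = "var_prime Z V :: (('v \<Rightarrow>\<^sub>0 nat) \<Rightarrow>\<^sub>0 'k) set"
  show "prime_height (mpoly_ring Z) ?P \<le> enat (card V)"
    by (rule prime_height_var_prime_le[OF finite_Z]) simp
  show "enat (card V) \<le> prime_height (mpoly_ring Z) ?P"
    by (rule prime_height_ge_card[OF prime_var_prime finite_V])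
      (auto simp: indet_in_var_prime)
qed

text \<open>A cover inside \<open>V\<close> contains no new vertex, so the whisker edges force it to be all of \<open>V\<close>.\<close>

lemma V_minimal_prime:
  "(var_prime Z V :: (('v \<Rightarrow>\<^sub>0 nat) \<Rightarrow>\<^sub>0 'k::field) set) \<in> minimal_primes (mpoly_ring Z) (edge_ideal Z whiskered_edges)"
  unfolding minimal_primes_def
proof (intro CollectI conjI allI impI; (elim conjE)?)
  show "primeideal (var_prime Z V :: (('v \<Rightarrow>\<^sub>0 nat) \<Rightarrow>\<^sub>0 'k) set) (mpoly_ring Z)" by (rule prime_var_prime)
  show "edge_ideal Z whiskered_edges \<subseteq> (var_prime Z V :: (('v \<Rightarrow>\<^sub>0 nat) \<Rightarrow>\<^sub>0 'k) set)"
    using edge_ideal_subset_var_prime_iff vertex_cover_V by blast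
next
  fix Q :: "(('v \<Rightarrow>\<^sub>0 nat) \<Rightarrow>\<^sub>0 'k) set"
  assume Q: "primeideal Q (mpoly_ring Z)" "edge_ideal Z whiskered_edges \<subseteq> Q" "Q \<subseteq> var_prime Z V"
  have "indet x \<in> Q" if x: "x \<in> V" for x
  proof -
    have "w x \<in> Z" "w x \<notin> V" using whisker[OF x] disjoint by auto
    then have "(indet (w x) :: ('v \<Rightarrow>\<^sub>0 nat) \<Rightarrow>\<^sub>0 'k) \<notin> var_prime Z V"
      by (simp only: indet_in_var_prime simp_thms)
    then have "(indet (w x) :: ('v \<Rightarrow>\<^sub>0 nat) \<Rightarrow>\<^sub>0 'k) \<notin> Q" using Q(3) by blast
    moreover have "{x, w x} \<in> whiskered_edges" using x by (auto simp: whiskered_edges_def)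
    ultimately show ?thesis
      using vertex_cover_of_prime[OF Q(1,2)] unfolding vertex_cover_def by blast
  qed
  then have "var_prime Z V \<subseteq> Q" by (intro var_prime_subset prime_is_ideal Q(1)) auto
  then show "Q = var_prime Z V" using Q(3) by blast
qed

text \<open>A new vertex \<open>y\<close> in a minimal cover is needed for some edge \<open>{x, y}\<close>, so \<open>x\<close> is missing. Thus the new
  vertices in the cover are at most as many as the elements of \<open>V\<close> outside it.\<close>

lemma card_minimal_cover_le:
  assumes "vertex_cover C" and minimal: "\<And>D. vertex_cover D \<Longrightarrow> D \<subseteq> C \<Longrightarrow> D = C"
  shows "card C \<le> card V"
proof -
  have C: "C \<subseteq> Z" using assms(1) by (simp add: vertex_cover_def)
  have "C \<inter> Y \<subseteq> w ` (V - C)"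
  proof
    fix y assume y: "y \<in> C \<inter> Y"
    then have "\<not> vertex_cover (C - {y})" using minimal[of "C - {y}"] by blast
    then obtain u v where uv: "{u, v} \<in> whiskered_edges" "u \<notin> C - {y}" "v \<notin> C - {y}"
      using C by (auto simp: vertex_cover_def)
    have cov: "u \<in> C \<or> v \<in> C" using uv(1) assms(1) by (auto simp: vertex_cover_def)
    then have "y \<in> {u, v}" using uv by auto
    then have "{u, v} \<notin> E" using edges[of "{u, v}"] y disjoint by blast
    then obtain x where x: "x \<in> V" "{u, v} = {x, w x}"
      using uv(1) by (auto simp: whiskered_edges_def)
    have "x \<noteq> y" using x y disjoint by auto
    then have "w x = y" using \<open>y \<in> {u, v}\<close> x(2) by auto
    moreover have "x \<notin> C" using x(2) uv(2,3) \<open>x \<noteq> y\<close> by (auto simp: doubleton_eq_iff)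
    ultimately show "y \<in> w ` (V - C)" using x(1) by blast
  qed
  then have "card (C \<inter> Y) \<le> card (V - C)"
    using finite_V by (meson card_image_le card_mono finite_Diff finite_imageI le_trans)
  moreover have "card C = card (C \<inter> V) + card (C \<inter> Y)"
  proof -
    have "C = (C \<inter> V) \<union> (C \<inter> Y)" using C by blast
    moreover have "card ((C \<inter> V) \<union> (C \<inter> Y)) = card (C \<inter> V) + card (C \<inter> Y)"
      using disjoint finite_V finite_Y by (intro card_Un_disjoint) auto
    ultimately show ?thesis by simp
  qed
  moreover have "card V = card (V \<inter> C) + card (V - C)"
    using finite_V card_Int_Diff by blast
  ultimately show ?thesis by (simp add: Int_commute)
qed

lemma bight_edge_ideal:
  "bight (mpoly_ring Z) (edge_ideal Z whiskered_edges :: (('v \<Rightarrow>\<^sub>0 nat) \<Rightarrow>\<^sub>0 'k::field) set) = enat (card V)"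
  unfolding bight_def
proof (rule antisym)
  let ?I = "edge_ideal Z whiskered_edges :: (('v \<Rightarrow>\<^sub>0 nat) \<Rightarrow>\<^sub>0 'k) set"
  show "enat (card V) \<le> (SUP P \<in> minimal_primes (mpoly_ring Z) ?I. prime_height (mpoly_ring Z) P)"
    using SUP_upper[OF V_minimal_prime, of "prime_height (mpoly_ring Z)"] by (simp add: prime_height_V)
  show "(SUP P \<in> minimal_primes (mpoly_ring Z) ?I. prime_height (mpoly_ring Z) P) \<le> enat (card V)"
  proof (rule SUP_least)
    fix P assume "P \<in> minimal_primes (mpoly_ring Z) ?I"
    then have P: "primeideal P (mpoly_ring Z)" "?I \<subseteq> P"
      and minimal: "\<And>Q. primeideal Q (mpoly_ring Z) \<Longrightarrow> ?I \<subseteq> Q \<Longrightarrow> Q \<subseteq> P \<Longrightarrow> Q = P"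
      by (auto simp: minimal_primes_def)
    define C where "C = {v \<in> Z. (indet v :: ('v \<Rightarrow>\<^sub>0 nat) \<Rightarrow>\<^sub>0 'k) \<in> P}"
    have C: "vertex_cover C" "C \<subseteq> Z" using vertex_cover_of_prime[OF P] by (auto simp: C_def)
    have D: "var_prime Z D = P" if "vertex_cover D" "D \<subseteq> C" for D
    proof (rule minimal[OF prime_var_prime])
      show "?I \<subseteq> var_prime Z D"
        using edge_ideal_subset_var_prime_iff[of D] that C(2) by auto
      show "var_prime Z D \<subseteq> P"
        using that(2) by (intro var_prime_subset prime_is_ideal P(1)) (auto simp: C_def)
    qed
    have "D = C" if "vertex_cover D" "D \<subseteq> C" for D
    proof -
      have "C \<subseteq> D"
      proof
        fix v assume "v \<in> C"
        then have "v \<in> Z" "(indet v :: ('v \<Rightarrow>\<^sub>0 nat) \<Rightarrow>\<^sub>0 'k) \<in> var_prime Z D"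
          using D[OF that] by (auto simp: C_def)
        then show "v \<in> D" by (simp only: indet_in_var_prime)
      qed
      then show ?thesis using that(2) by blast
    qed
    then have "card C \<le> card V" using card_minimal_cover_le C(1) by blast
    moreover have "prime_height (mpoly_ring Z) P \<le> enat (card C)"
      using prime_height_var_prime_le[OF finite_Z C(2)] D[OF C(1)] by auto
    ultimately show "prime_height (mpoly_ring Z) P \<le> enat (card V)"
      using order_trans by fastforce
  qed
qed

text \<open>The factors \<open>w x\<close> are dropped as soon as \<open>A\<close> contains an edge. Then an edge \<open>{u, v}\<close> yields the
  generator \<open>u * v\<close> itself, and divisibility of \<open>layer_product A * layer_product B\<close> by
  \<open>layer_product (A \<union> B)\<close> is kept: if \<open>A\<close> or \<open>B\<close> contains an edge, so does \<open>A \<union> B\<close>.\<close>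

definition layer_product :: "'v set \<Rightarrow> (('v \<Rightarrow>\<^sub>0 nat) \<Rightarrow>\<^sub>0 'k::field)" where
  "layer_product A =
    (\<Prod>x\<in>A. indet x) * (if \<exists>e\<in>E. e \<subseteq> A then 1 else \<Prod>x\<in>A. indet (w x))"

lemma prod_indet_in_polys:
  "A \<subseteq> V \<Longrightarrow> (\<Prod>x\<in>A. indet x) \<in> (polys Z :: (('v \<Rightarrow>\<^sub>0 nat) \<Rightarrow>\<^sub>0 'k::field) set)"
  "A \<subseteq> V \<Longrightarrow> (\<Prod>x\<in>A. indet (w x)) \<in> (polys Z :: (('v \<Rightarrow>\<^sub>0 nat) \<Rightarrow>\<^sub>0 'k::field) set)"
  using whisker by (auto intro!: polys_prod indet_in_polys)

lemma layer_product_in_polys: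
  "A \<subseteq> V \<Longrightarrow> layer_product A \<in> (polys Z :: (('v \<Rightarrow>\<^sub>0 nat) \<Rightarrow>\<^sub>0 'k::field) set)"
  using prod_indet_in_polys by (auto simp: layer_product_def)

lemma layer_product_mult:
  assumes "A \<subseteq> V" "B \<subseteq> V"
  shows "\<exists>r \<in> polys Z. layer_product A * layer_product B =
    r * (layer_product (A \<union> B) :: ('v \<Rightarrow>\<^sub>0 nat) \<Rightarrow>\<^sub>0 'k::field)"
proof -
  have fin: "finite A" "finite B" using assms finite_V finite_subset by auto
  have union: "prod f A * prod f B = prod f (A \<inter> B) * prod f (A \<union> B)"
    for f :: "'v \<Rightarrow> ('v \<Rightarrow>\<^sub>0 nat) \<Rightarrow>\<^sub>0 'k"
    using prod.union_inter[OF fin, of f] by (simp add: mult.commute)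
  define tail :: "'v set \<Rightarrow> ('v \<Rightarrow>\<^sub>0 nat) \<Rightarrow>\<^sub>0 'k"
    where "tail A = (if \<exists>e\<in>E. e \<subseteq> A then 1 else \<Prod>x\<in>A. indet (w x))" for A
  have tail_polys: "tail A \<in> polys Z" if "A \<subseteq> V" for A
    by (simp add: tail_def prod_indet_in_polys(2)[OF that])
  have "\<exists>r\<in>polys Z. tail A * tail B = r * tail (A \<union> B)"
  proof (cases "\<exists>e\<in>E. e \<subseteq> A \<union> B")
    case True
    then have "tail (A \<union> B) = 1" by (simp add: tail_def)
    then show ?thesis using tail_polys assms by (intro bexI[of _ "tail A * tail B"]) auto
  next
    case False
    then have "tail A * tail B = (\<Prod>x\<in>A \<inter> B. indet (w x)) * tail (A \<union> B)"
      using union[of "\<lambda>x. indet (w x)"] by (auto simp: tail_def)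
    moreover have "(\<Prod>x\<in>A \<inter> B. indet (w x)) \<in> (polys Z :: (('v \<Rightarrow>\<^sub>0 nat) \<Rightarrow>\<^sub>0 'k) set)"
      using assms by (intro prod_indet_in_polys(2)) auto
    ultimately show ?thesis by (intro bexI[of _ "\<Prod>x\<in>A \<inter> B. indet (w x)"])
  qed
  then obtain r where r: "r \<in> polys Z" "tail A * tail B = r * tail (A \<union> B)" by blast
  have "layer_product A * layer_product B = (prod indet A * prod indet B) * (tail A * tail B)"
    by (simp add: layer_product_def tail_def ac_simps)
  also have "\<dots> = (prod indet (A \<inter> B) * r) * layer_product (A \<union> B)"
    by (simp only: union r(2)) (simp add: layer_product_def tail_def ac_simps)
  finally have "layer_product A * layer_product B = (prod indet (A \<inter> B) * r) * layer_product (A \<union> B)" .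
  moreover have "prod indet (A \<inter> B) * r \<in> polys Z"
    using r(1) assms by (intro polys_closed prod_indet_in_polys(1)) auto
  ultimately show ?thesis by (intro bexI[of _ "prod indet (A \<inter> B) * r"])
qed

lemma layer_product_mem:
  assumes "A \<subseteq> V" "A \<noteq> {}"
  shows "layer_product A \<in> (edge_ideal Z whiskered_edges :: (('v \<Rightarrow>\<^sub>0 nat) \<Rightarrow>\<^sub>0 'k::field) set)"
proof (cases "\<exists>e\<in>E. e \<subseteq> A")
  case True
  then obtain u v where uv: "{u, v} \<in> E" "u \<noteq> v" "u \<in> A" "v \<in> A"
    using edges by (metis card_2_iff insert_subset)
  have fin: "finite A" using assms finite_V finite_subset by blast
  have "(layer_product A :: ('v \<Rightarrow>\<^sub>0 nat) \<Rightarrow>\<^sub>0 'k) = indet u * indet v * (\<Prod>x\<in>A - {u} - {v}. indet x)"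
    using True uv fin by (simp add: layer_product_def prod.remove[of A u] prod.remove[of "A - {u}" v] mult.assoc)
  moreover have "indet u * indet v \<in> (edge_ideal Z whiskered_edges :: (('v \<Rightarrow>\<^sub>0 nat) \<Rightarrow>\<^sub>0 'k) set)"
    using uv(1) by (intro edge_product_mem) (simp add: whiskered_edges_def)
  moreover have "(\<Prod>x\<in>A - {u} - {v}. indet x) \<in> (polys Z :: (('v \<Rightarrow>\<^sub>0 nat) \<Rightarrow>\<^sub>0 'k) set)"
    using assms by (intro prod_indet_in_polys) auto
  ultimately show ?thesis using ideal_mult_right[OF ideal_edge_ideal] by simp
next
  case False
  from assms obtain x where x: "x \<in> A" by blast
  have fin: "finite A" using assms finite_V finite_subset by blast
  let ?r = "(\<Prod>x\<in>A - {x}. indet x) * (\<Prod>x\<in>A - {x}. indet (w x)) :: ('v \<Rightarrow>\<^sub>0 nat) \<Rightarrow>\<^sub>0 'k"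
  have "layer_product A = ?r * (indet x * indet (w x))"
    unfolding layer_product_def if_not_P[OF False] prod.remove[OF fin x] by (simp add: ac_simps)
  moreover have "indet x * indet (w x) \<in> (edge_ideal Z whiskered_edges :: (('v \<Rightarrow>\<^sub>0 nat) \<Rightarrow>\<^sub>0 'k) set)"
    using x assms by (intro edge_product_mem) (auto simp: whiskered_edges_def)
  moreover have "?r \<in> polys Z"
    using assms by (intro polys_closed prod_indet_in_polys) auto
  ultimately show ?thesis using ideal_mult[OF ideal_edge_ideal] by simp
qed

lemma ara_edge_ideal_le:
  "ara (mpoly_ring Z) (edge_ideal Z whiskered_edges :: (('v \<Rightarrow>\<^sub>0 nat) \<Rightarrow>\<^sub>0 'k::field) set) \<le> enat (card V)"
proof -
  let ?I = "edge_ideal Z whiskered_edges :: (('v \<Rightarrow>\<^sub>0 nat) \<Rightarrow>\<^sub>0 'k) set"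
  define q :: "nat \<Rightarrow> ('v \<Rightarrow>\<^sub>0 nat) \<Rightarrow>\<^sub>0 'k"
    where "q l = (\<Sum>A | A \<subseteq> V \<and> card A = l. layer_product A)" for l
  define as where "as = map q [1..<Suc (card V)]"
  let ?J = "Idl\<^bsub>mpoly_ring Z\<^esub> (set as)"
  have set_as: "set as = q ` {1..card V}" by (auto simp: as_def simp del: upt_Suc)
  have q_mem: "q l \<in> ?I" if "l \<ge> 1" for l
    unfolding q_def using that by (intro ideal_sum[OF ideal_edge_ideal] layer_product_mem) auto
  have as_I: "set as \<subseteq> ?I" using q_mem by (auto simp: set_as)
  then have as_polys: "set as \<subseteq> polys Z" using ideal_in_polys[OF ideal_edge_ideal] by blast
  note J = ideal_Idl[OF as_polys]
  have rad: "layer_product A \<in> radical (mpoly_ring Z) ?J" if "A \<subseteq> V" "A \<noteq> {}" for A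
  proof (rule radical_of_layer_sums[OF finite_V J layer_product_in_polys layer_product_mult _ that])
    show "(\<Sum>A | A \<subseteq> V \<and> card A = l. layer_product A) \<in> ?J" if "1 \<le> l" "l \<le> card V" for l
      using subset_Idl[OF as_polys] that by (auto simp: set_as q_def)
  qed
  have "indet u * indet v \<in> radical (mpoly_ring Z) ?J" if uv: "{u, v} \<in> whiskered_edges" for u v
  proof (cases "{u, v} \<in> E")
    case True
    then have "{u, v} \<subseteq> V" "u \<noteq> v" using edges[OF True] by auto
    moreover have "\<exists>e\<in>E. e \<subseteq> {u, v}" using True by blast
    ultimately show ?thesis
      using rad[of "{u, v}"] unfolding layer_product_def by (simp only: if_True) simp
  next
    case False
    then obtain x where x: "x \<in> V" "{u, v} = {x, w x}"
      using uv by (auto simp: whiskered_edges_def)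
    have "\<not> e \<subseteq> {x}" if "e \<in> E" for e
      using edges[OF that] card_mono[of "{x}" e] by auto
    then have "\<not> (\<exists>e\<in>E. e \<subseteq> {x})" by blast
    then have "indet x * indet (w x) \<in> radical (mpoly_ring Z) ?J"
      using rad[of "{x}"] x(1) by (simp add: layer_product_def)
    then show ?thesis using x(2) by (auto simp: doubleton_eq_iff mult.commute)
  qed
  then have "?I \<subseteq> radical (mpoly_ring Z) ?J"
    using edge_ideal_subset_iff[OF ideal_radical[OF J]] by blast
  then have "radical (mpoly_ring Z) ?I \<subseteq> radical (mpoly_ring Z) ?J"
    using ideal_in_polys[OF J] by (intro radical_mono_ideal) auto
  moreover have "?J \<subseteq> ?I" using Idl_subset[OF ideal_edge_ideal as_I] .
  then have "radical (mpoly_ring Z) ?J \<subseteq> radical (mpoly_ring Z) ?I"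
    by (auto simp: radical_def)
  ultimately have "radical (mpoly_ring Z) ?J = radical (mpoly_ring Z) ?I" by blast
  moreover have "length as = card V" by (simp add: as_def del: upt_Suc)
  ultimately show ?thesis
    unfolding ara_def using as_polys by (intro INF_lower) auto
qed

text \<open>Setting the new vertices to \<open>1\<close> maps generators of \<open>I\<close> up to radical to polynomials in the variables
  \<open>V\<close>. They have no constant term because \<open>I \<subseteq> var_prime Z V\<close>, and a power of each \<open>x \<in> V\<close> lies in the
  ideal that they generate because a power of \<open>x * w x\<close> lies in the original one.\<close>

lemma ara_edge_ideal_ge:
  "enat (card V) \<le> ara (mpoly_ring Z) (edge_ideal Z whiskered_edges :: (('v \<Rightarrow>\<^sub>0 nat) \<Rightarrow>\<^sub>0 'k::field) set)"
  unfolding ara_def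
proof (rule INF_greatest, clarify)
  let ?I = "edge_ideal Z whiskered_edges :: (('v \<Rightarrow>\<^sub>0 nat) \<Rightarrow>\<^sub>0 'k) set"
  fix as :: "(('v \<Rightarrow>\<^sub>0 nat) \<Rightarrow>\<^sub>0 'k) list"
  assume "set as \<subseteq> carrier (mpoly_ring Z)"
    and rad: "radical (mpoly_ring Z) (Idl\<^bsub>mpoly_ring Z\<^esub> (set as)) = radical (mpoly_ring Z) ?I"
  then have as: "set as \<subseteq> polys Z" by simp
  define b where "b i = set_one_outside V (as ! i)" for i
  have "card V \<le> length as"
  proof (rule card_le_number_of_generators[OF finite_V])
    fix i assume "i < length as"
    then have "as ! i \<in> Idl\<^bsub>mpoly_ring Z\<^esub> (set as)"
      using subset_Idl[OF as] nth_mem by blast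
    moreover have "Idl\<^bsub>mpoly_ring Z\<^esub> (set as) \<subseteq> radical (mpoly_ring Z) ?I"
      using ideal_in_polys[OF ideal_Idl[OF as]] unfolding rad [symmetric]
      by (intro subset_radical subsetI)
    ultimately have "as ! i \<in> radical (mpoly_ring Z) ?I" by blast
    then obtain k where "as ! i \<in> polys Z" "(as ! i) ^ k \<in> ?I" by (auto simp: radical_def)
    moreover have "?I \<subseteq> var_prime Z V"
      by (simp add: edge_ideal_subset_var_prime_iff vertex_cover_V)
    ultimately have "as ! i \<in> var_prime Z V"
      by (intro prime_power[OF prime_var_prime, of "as ! i" Z k]) auto
    then show "b i \<in> order_at_least V 1"
      unfolding b_def by (rule set_one_var_prime[OF finite_V])
  next
    fix v assume v: "v \<in> V"
    have "indet v * indet (w v) \<in> ?I"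
      using v by (intro edge_product_mem) (auto simp: whiskered_edges_def)
    then have "indet v * indet (w v) \<in> radical (mpoly_ring Z) (Idl\<^bsub>mpoly_ring Z\<^esub> (set as))"
      unfolding rad
      by (intro subsetD[OF subset_radical] subsetI ideal_in_polys[OF ideal_edge_ideal])
    then obtain k where "(indet v * indet (w v)) ^ k \<in> Idl\<^bsub>mpoly_ring Z\<^esub> (set as)"
      by (auto simp: radical_def)
    from Idl_list_combination[OF as this] obtain g
      where g: "(indet v * indet (w v)) ^ k = (\<Sum>i<length as. as ! i * g i)" .
    have "w v \<notin> V" using whisker[OF v] disjoint by auto
    then have "indet v ^ k = set_one_outside V ((indet v * indet (w v)) ^ k)"
      using v by (simp add: set_one_power set_one_mult set_one_indet)
    also have "\<dots> = (\<Sum>i<length as. b i * set_one_outside V (g i))"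
      by (simp add: g set_one_sum set_one_mult b_def)
    finally show "\<exists>k g. (\<forall>i. g i \<in> polys V) \<and> indet v ^ k = (\<Sum>i<length as. b i * g i)"
      by (intro exI[of _ k] exI[of _ "\<lambda>i. set_one_outside V (g i)"]) auto
  qed
  then show "enat (card V) \<le> enat (length as)" by simp
qed

lemma ara_edge_ideal:
  "ara (mpoly_ring Z) (edge_ideal Z whiskered_edges :: (('v \<Rightarrow>\<^sub>0 nat) \<Rightarrow>\<^sub>0 'k::field) set) = enat (card V)"
  using ara_edge_ideal_le ara_edge_ideal_ge by (rule antisym)

lemma height_edge_ideal:
  assumes covers: "\<And>C. vertex_cover C \<Longrightarrow> card V \<le> card C"
  shows "height (mpoly_ring Z) (edge_ideal Z whiskered_edges :: (('v \<Rightarrow>\<^sub>0 nat) \<Rightarrow>\<^sub>0 'k::field) set) = enat (card V)"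
  unfolding height_def
proof (rule antisym)
  let ?I = "edge_ideal Z whiskered_edges :: (('v \<Rightarrow>\<^sub>0 nat) \<Rightarrow>\<^sub>0 'k) set"
  let ?S = "{P. primeideal P (mpoly_ring Z) \<and> ?I \<subseteq> P}"
  have "var_prime Z V \<in> ?S"
    using V_minimal_prime by (auto simp: minimal_primes_def)
  then have "(INF P \<in> ?S. prime_height (mpoly_ring Z) P) \<le> prime_height (mpoly_ring Z) (var_prime Z V :: (('v \<Rightarrow>\<^sub>0 nat) \<Rightarrow>\<^sub>0 'k) set)"
    by (rule INF_lower)
  then show "(INF P \<in> ?S. prime_height (mpoly_ring Z) P) \<le> enat (card V)"
    by (simp add: prime_height_V)
  show "enat (card V) \<le> (INF P \<in> ?S. prime_height (mpoly_ring Z) P)"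
  proof (rule INF_greatest)
    fix P assume "P \<in> ?S"
    then have P: "primeideal P (mpoly_ring Z)" "?I \<subseteq> P" by auto
    let ?C = "{v \<in> Z. (indet v :: ('v \<Rightarrow>\<^sub>0 nat) \<Rightarrow>\<^sub>0 'k) \<in> P}"
    have "enat (card V) \<le> enat (card ?C)"
      using covers[OF vertex_cover_of_prime[OF P]] by simp
    also have "\<dots> \<le> prime_height (mpoly_ring Z) P"
      using finite_Z by (intro prime_height_ge_card[OF P(1)]) auto
    finally show "enat (card V) \<le> prime_height (mpoly_ring Z) P" .
  qed
qed

text \<open>Two distinct vertices of \<open>V\<close> outside a cover are not adjacent, so they have different whiskers if
  vertices with the same whisker are adjacent, and these whiskers belong to the cover.\<close>

lemma card_cover_ge:
  assumes cliques: "\<And>u v. u \<in> V \<Longrightarrow> v \<in> V \<Longrightarrow> w u = w v \<Longrightarrow> u \<noteq> v \<Longrightarrow> {u, v} \<in> E"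
    and C: "vertex_cover C"
  shows "card V \<le> card C"
proof -
  have cov: "u \<in> C \<or> v \<in> C" if "{u, v} \<in> whiskered_edges" for u v
    using C that by (auto simp: vertex_cover_def)
  have "inj_on w (V - C)"
    using cliques cov unfolding inj_on_def whiskered_edges_def by blast
  then have "card (V - C) = card (w ` (V - C))" by (simp add: card_image)
  moreover have "w ` (V - C) \<subseteq> C \<inter> Y"
    using cov whisker unfolding whiskered_edges_def by blast
  moreover have "finite C" using C finite_Z finite_subset unfolding vertex_cover_def by blast
  ultimately have "card (V - C) \<le> card (C \<inter> Y)" by (simp add: card_mono)
  moreover have "card (C \<inter> V) + card (C \<inter> Y) = card ((C \<inter> V) \<union> (C \<inter> Y))"
    using disjoint finite_V finite_Y by (intro card_Un_disjoint[symmetric]) auto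
  moreover have "card ((C \<inter> V) \<union> (C \<inter> Y)) \<le> card C"
    using \<open>finite C\<close> by (intro card_mono) auto
  moreover have "card V = card (V \<inter> C) + card (V - C)"
    using finite_V card_Int_Diff by blast
  ultimately show ?thesis by (simp add: Int_commute)
qed

end

lemma whiskered_graph_of_partition:
  assumes "simple_graph V E" "indexed_partition V t W" "new_vertices V t y"
  obtains w where "whiskered_graph V (y ` {1..t}) E w"
    and "whisker_edges E t W y = whiskered_graph.whiskered_edges V E w"
    and "\<And>u v. u \<in> V \<Longrightarrow> v \<in> V \<Longrightarrow> w u = w v \<Longrightarrow> \<exists>i\<in>{1..t}. u \<in> W i \<and> v \<in> W i"
proof -
  have V: "V = (\<Union>i\<in>{1..t}. W i)" and disj: "disjoint_family_on W {1..t}"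
    using assms(2) by (auto simp: indexed_partition_def)
  then have "\<forall>x\<in>V. \<exists>i. i \<in> {1..t} \<and> x \<in> W i" by auto
  then obtain i where i: "\<And>x. x \<in> V \<Longrightarrow> i x \<in> {1..t} \<and> x \<in> W (i x)" by metis
  have i_unique: "j = i x" if "j \<in> {1..t}" "x \<in> W j" for j x
  proof -
    have "x \<in> V" using V that by blast
    then show ?thesis using i[of x] that disj unfolding disjoint_family_on_def by blast
  qed
  let ?w = "\<lambda>x. y (i x)"
  have graph: "whiskered_graph V (y ` {1..t}) E ?w"
    using assms(1,3) i by unfold_locales (auto simp: simple_graph_def new_vertices_def)
  moreover have "whisker_edges E t W y = whiskered_graph.whiskered_edges V E ?w"
    unfolding whiskered_graph.whiskered_edges_def[OF graph] whisker_edges_def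
    using i i_unique V by blast
  moreover have "\<exists>j\<in>{1..t}. u \<in> W j \<and> v \<in> W j" if "u \<in> V" "v \<in> V" "?w u = ?w v" for u v
  proof -
    have "i u = i v"
      using that i assms(3) unfolding new_vertices_def inj_on_def by blast
    then show ?thesis using i that by metis
  qed
  ultimately show ?thesis using that by blast
qed

theorem proposition3p1:
  fixes V V' U :: "'v set" and E E' F :: "'v set set" and n t :: nat
    and W :: "nat \<Rightarrow> 'v set" and y :: "nat \<Rightarrow> 'v"
    and I J :: "(('v \<Rightarrow>\<^sub>0 nat) \<Rightarrow>\<^sub>0 'k::field) set"
  shows "(simple_graph V E \<and> card V = n \<and> n \<ge> 1 \<and>
      indexed_partition V t W \<and> new_vertices V t y \<and>
      V' = whisker_vertices V t y \<and> E' = whisker_edges E t W y \<and>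
      I = edge_ideal V' E' \<longrightarrow>
      bight (mpoly_ring V') I = enat n \<and> ara (mpoly_ring V') I = enat n) \<and>
    (fully_clique_whiskered U F \<and> J = edge_ideal U F \<longrightarrow>
      set_theoretic_complete_intersection (mpoly_ring U) J)"
proof (intro conjI[where P = "_ \<longrightarrow> _"] impI; elim conjE)
  assume graph: "simple_graph V E" "indexed_partition V t W" "new_vertices V t y"
    and n: "card V = n" and eqs: "V' = whisker_vertices V t y" "E' = whisker_edges E t W y"
    "I = edge_ideal V' E'"
  from whiskered_graph_of_partition[OF graph] obtain w where w: "whiskered_graph V (y ` {1..t}) E w"
    "whisker_edges E t W y = whiskered_graph.whiskered_edges V E w" by metis
  show "bight (mpoly_ring V') I = enat n \<and> ara (mpoly_ring V') I = enat n"
    using whiskered_graph.bight_edge_ideal[OF w(1)] whiskered_graph.ara_edge_ideal[OF w(1)]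
    by (simp add: eqs w(2) whisker_vertices_def n)
next
  assume U: "fully_clique_whiskered U F" and J: "J = edge_ideal U F"
  then obtain V E t W y where graph: "simple_graph V E" "indexed_partition V t W" "new_vertices V t y"
    and clique: "\<forall>i\<in>{1..t}. clique V E (W i)"
    and eqs: "U = whisker_vertices V t y" "F = whisker_edges E t W y"
    by (auto simp: fully_clique_whiskered_def)
  from whiskered_graph_of_partition[OF graph] obtain w where w: "whiskered_graph V (y ` {1..t}) E w"
    "whisker_edges E t W y = whiskered_graph.whiskered_edges V E w"
    and same: "\<And>u v. u \<in> V \<Longrightarrow> v \<in> V \<Longrightarrow> w u = w v \<Longrightarrow> \<exists>i\<in>{1..t}. u \<in> W i \<and> v \<in> W i" by metis
  interpret whiskered_graph V "y ` {1..t}" E w by (rule w(1))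
  have "{u, v} \<in> E" if "u \<in> V" "v \<in> V" "w u = w v" "u \<noteq> v" for u v
    using same[OF that(1-3)] clique that(4) unfolding clique_def by blast
  then have "height (mpoly_ring U) J = enat (card V)"
    using height_edge_ideal card_cover_ge by (simp add: J eqs w(2) whisker_vertices_def)
  moreover have "ara (mpoly_ring U) J = enat (card V)"
    using ara_edge_ideal by (simp add: J eqs w(2) whisker_vertices_def)
  ultimately show "set_theoretic_complete_intersection (mpoly_ring U) J"
    by (simp add: set_theoretic_complete_intersection_def)
qed

end
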